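(* Let $0<r<1/2$ and $s=\frac{2r}{1-2r}$ (so $r=\frac{s}{2+2s}$). For every $P_0>0$ the ball $U=\mathbb B^s_{2\infty}(P_0)$, defined with the orthonormal functions $\phi_j(x)=\sqrt2\cos(\pi jx)$, $x\in[0,1]$, $1\le j<\infty$, is a maxiset for the Cramér–von Mises test statistics; that is, $U$ is convex and: (i) for any constants $0<c<C$ there is a constant $c_1>0$ such that for all $n$ and all $f=\frac{d(F-F_0)}{dx}\in U$ with $cn^{-r}<\|f\|<Cn^{-r}$ there holds $\sqrt n\,T(F-F_0)>c_1$; (ii) for any $f\in\mathbb L_2(0,1)$ with $\int_0^1f(x)dx=0$ and $f\notin\lambda U$ for all $\lambda>0$, there are sequences of positive integers $i_n\to\infty$ and $j_n$ and constants $0<c_2\le C_2$ with $c_2j_n^{-r}\le\|\tilde f_{i_n}\|\le C_2j_n^{-r}$ such that, if $1+\tilde f_{i_n}(x)>0$ for all $x\in(0,1)$, then $$\lim_{n\to\infty}j_n^{1/2}\,T(\tilde F_{i_n}-F_0)=0,\qquad\text{where } \frac{d\tilde F_{i_n}}{dx}-1=\tilde f_{i_n}.$$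
   Context: $X_1,\dots,X_n$ are i.i.d. with c.d.f. $F$ on $(0,1)$ having density $1+f$, $f\in\mathbb L_2(0,1)$, $\int_0^1f=0$; $F_0(x)=x$, $x\in(0,1)$; $\|\cdot\|$ is the $\mathbb L_2(0,1)$ norm; the hypothesis is $F=F_0$. The Cramér–von Mises functional is $T^2(F-F_0)=\int_0^1(F(x)-F_0(x))^2dF_0(x)$, and the test statistics are $T(\hat F_n-F_0)$, $\hat F_n$ the empirical c.d.f. A sequence of alternatives $F_n$ is consistent for these statistics iff $nT^2(F_n-F_0)>c$ for all $n>n_0$ for some $c>0$; accordingly a maxiset in this setting is a convex set satisfying (i) and (ii) of the claim ((ii) expresses maximality). Balls: $\mathbb B^s_{2\infty}(P_0)=\{f=\sum_{j=1}^\infty\theta_j\phi_j:\ \sup_{\lambda>0}\lambda^{2s}\sum_{j>\lambda}\theta_j^2\le P_0,\ \theta_j\in\mathbb R\}$, and $\lambda U=\{\lambda g:g\in U\}$. For $f=\sum_{j\ge1}\theta_j\phi_j$, $\tilde f_i=\sum_{j>i}\theta_j\phi_j$ (the remainder of $f$ after projection on $\mathrm{span}(\phi_1,\dots,\phi_i)$). *)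

theory Defs
  imports "HOL-Probability.Probability"
begin

text \<open>
  Elements of \<open>L\<^sub>2(0,1)\<close> are represented by Borel functions \<open>real \<Rightarrow> real\<close>; only the values on
  \<open>(0,1)\<close> matter, and all notions below respect almost-everywhere equality there.
\<close>

definition unit_lborel :: "real measure" where
  "unit_lborel = restrict_space lborel {0<..<1}"

definition L2_space :: "(real \<Rightarrow> real) set" where
  "L2_space = {f \<in> borel_measurable unit_lborel. integrable unit_lborel (\<lambda>x. (f x)\<^sup>2)}"

definition L2_norm :: "(real \<Rightarrow> real) \<Rightarrow> real" where
  "L2_norm f = sqrt (LINT x|unit_lborel. (f x)\<^sup>2)"

definition cos_basis :: "nat \<Rightarrow> real \<Rightarrow> real" where
  "cos_basis j x = sqrt 2 * cos (pi * real j * x)"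

definition L2_expansion :: "(real \<Rightarrow> real) \<Rightarrow> (nat \<Rightarrow> real) \<Rightarrow> bool" where
  "L2_expansion f \<theta> \<longleftrightarrow>
     (\<lambda>N. L2_norm (\<lambda>x. f x - (\<Sum>j=1..N. \<theta> j * cos_basis j x))) \<longlonglongrightarrow> 0"

text \<open>
  The index \<open>j\<close> in the tail sum is automatically at least 1. Since the \<open>cos_basis j\<close> with \<open>j \<ge> 1\<close>
  are orthonormal, \<open>L2_expansion f \<theta>\<close> for \<open>f \<in> L2_space\<close> makes \<open>\<theta>\<close> square-summable, so the
  infinite sum never takes its default value. The supremum is taken in \<open>[0,\<infinity>]\<close>.
\<close>

definition besov_ball :: "real \<Rightarrow> real \<Rightarrow> (real \<Rightarrow> real) set" where
  "besov_ball s P = {f \<in> L2_space. \<exists>\<theta>. L2_expansion f \<theta> \<and>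
     (SUP l\<in>{0<..}. ennreal (l powr (2 * s) * (\<Sum>\<^sub>\<infinity>j\<in>{j. l < real j}. (\<theta> j)\<^sup>2))) \<le> ennreal P}"

text \<open>The type \<open>real \<Rightarrow> real\<close> is no \<open>real_vector\<close> instance, so \<open>convex\<close> does not apply to it.\<close>

definition convex_fun_set :: "(real \<Rightarrow> real) set \<Rightarrow> bool" where
  "convex_fun_set U \<longleftrightarrow>
     (\<forall>g\<in>U. \<forall>h\<in>U. \<forall>u\<ge>0. \<forall>v\<ge>0. u + v = 1 \<longrightarrow> (\<lambda>x. u * g x + v * h x) \<in> U)"

definition scaled_set :: "real \<Rightarrow> (real \<Rightarrow> real) set \<Rightarrow> (real \<Rightarrow> real) set" where
  "scaled_set l U = (\<lambda>g x. l * g x) ` U"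

definition remainder :: "(real \<Rightarrow> real) \<Rightarrow> nat \<Rightarrow> real \<Rightarrow> real" where
  "remainder f i x =
     f x - (\<Sum>j=1..i. (LINT y|unit_lborel. f y * cos_basis j y) * cos_basis j x)"

text \<open>
  The c.d.f. of the law on \<open>(0,1)\<close> with Lebesgue density \<open>1 + f\<close>. As \<open>ennreal\<close> cuts off negative
  values, this is meaningful only if \<open>1 + f \<ge> 0\<close> almost everywhere on \<open>(0,1)\<close>.
\<close>

definition pert_cdf :: "(real \<Rightarrow> real) \<Rightarrow> real \<Rightarrow> real" where
  "pert_cdf f = cdf (density lborel (\<lambda>x. ennreal (1 + f x) * indicator {0<..<1} x))"

definition F0 :: "real \<Rightarrow> real" where
  "F0 x = x"

text \<open>\<open>dF0\<close> is Lebesgue measure on \<open>(0,1)\<close>.\<close>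

definition cvm_T :: "(real \<Rightarrow> real) \<Rightarrow> real" where
  "cvm_T G = sqrt (LINT x|unit_lborel. (G x)\<^sup>2)"

end

theory Submission
  imports Defs
begin

text \<open>
  Let \<open>\<theta>\<^sub>j\<close> be the cosine coefficients of \<open>f\<close>. The primitive of \<open>f\<close> vanishing at \<open>0\<close> has the
  coefficients \<open>\<theta>\<^sub>j / (\<pi> j)\<close> in the orthonormal system \<open>\<surd>2 sin (\<pi> j x)\<close>, whence
  \<open>T\<^sup>2 = \<Sum> \<theta>\<^sub>j\<^sup>2 / (\<pi> j)\<^sup>2\<close>, while \<open>\<parallel>f\<parallel>\<^sup>2 = \<Sum> \<theta>\<^sub>j\<^sup>2\<close>.

  For \<open>f\<close> in the ball and \<open>\<parallel>f\<parallel> > c n\<^bsup>-r\<^esup>\<close>, the coefficients beyond \<open>l\<close>, a suitable multiple of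
  \<open>n\<^bsup>r/s\<^esup>\<close>, carry at most half of \<open>c\<^sup>2 n\<^bsup>-2r\<^esup>\<close>; the others give
  \<open>n T\<^sup>2 \<ge> const \<cdot> n\<^bsup>1-2r-2r/s\<^esup> = const\<close>.

  If \<open>f\<close> lies in no multiple of the ball, the quantities \<open>i\<^sup>s \<parallel>R\<^sub>i\<parallel>\<close> are unbounded, where \<open>R\<^sub>i\<close> is
  the remainder of \<open>f\<close>. With \<open>j\<close> of order \<open>\<parallel>R\<^sub>i\<parallel>\<^bsup>-1/r\<^esup>\<close> the estimate \<open>T \<le> \<parallel>R\<^sub>i\<parallel> / (\<pi> i)\<close> yields
  \<open>j\<^bsup>1/2\<^esup> T \<le> const \<cdot> (i\<^sup>s \<parallel>R\<^sub>i\<parallel>)\<^bsup>-1/s\<^esup>\<close>, which tends to \<open>0\<close> along a subsequence. This part needs the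
  completeness of the cosine system: without it, \<open>f\<close> could be outside all multiples of the ball for
  lack of an expansion.
\<close>

section \<open>Lebesgue measure on the unit interval as a probability space\<close>

interpretation unit_lborel: prob_space unit_lborel
  by standard (simp add: unit_lborel_def space_restrict_space emeasure_restrict_space)

lemma space_unit_lborel [simp]: "space unit_lborel = {0<..<1}"
  by (simp add: unit_lborel_def space_restrict_space)

lemma borel_measurable_unit_lborel [measurable (raw)]:
  "f \<in> borel_measurable borel \<Longrightarrow> f \<in> borel_measurable unit_lborel"
  by (simp add: unit_lborel_def measurable_restrict_space1)

lemma integral_unit_lborel:
  fixes f :: "real \<Rightarrow> real"
  shows "(LINT x|unit_lborel. f x) = (LINT x|lborel. indicator {0<..<1} x * f x)"
  by (simp add: unit_lborel_def integral_restrict_space)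

lemma AE_unit_lborel_iff:
  "(AE x in unit_lborel. P x) \<longleftrightarrow> (AE x in lborel. x \<in> {0<..<1} \<longrightarrow> P x)"
  unfolding unit_lborel_def by (subst AE_restrict_space_iff) auto

subsection \<open>The inner product on the square-integrable functions\<close>

definition L2_inner :: "(real \<Rightarrow> real) \<Rightarrow> (real \<Rightarrow> real) \<Rightarrow> real" where
  "L2_inner f g = (LINT x|unit_lborel. f x * g x)"

lemma L2_spaceD:
  assumes "f \<in> L2_space"
  shows "f \<in> borel_measurable unit_lborel" "integrable unit_lborel (\<lambda>x. (f x)\<^sup>2)"
  using assms by (auto simp: L2_space_def)

lemma L2_mult_integrable:
  assumes "f \<in> L2_space" "g \<in> L2_space"
  shows "integrable unit_lborel (\<lambda>x. f x * g x)"
proof (rule Bochner_Integration.integrable_bound)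
  note [measurable] = L2_spaceD(1)[OF assms(1)] L2_spaceD(1)[OF assms(2)]
  show "integrable unit_lborel (\<lambda>x. (f x)\<^sup>2 + (g x)\<^sup>2)"
    using assms by (intro Bochner_Integration.integrable_add L2_spaceD)
  show "(\<lambda>x. f x * g x) \<in> borel_measurable unit_lborel" by measurable
  have "\<bar>a * b\<bar> \<le> a\<^sup>2 + b\<^sup>2" for a b :: real
    using sum_squares_bound[of "\<bar>a\<bar>" "\<bar>b\<bar>"] abs_ge_zero[of "a * b"]
    by (simp only: abs_mult power2_abs)
  then show "AE x in unit_lborel. norm (f x * g x) \<le> norm ((f x)\<^sup>2 + (g x)\<^sup>2)"
    by simp
qed

lemma L2_scale [intro]:
  assumes "f \<in> L2_space"
  shows "(\<lambda>x. a * f x) \<in> L2_space"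
proof -
  note [measurable] = L2_spaceD(1)[OF assms]
  show ?thesis
    using L2_spaceD(2)[OF assms] by (simp add: L2_space_def power_mult_distrib)
qed

lemma L2_add [intro]:
  assumes "f \<in> L2_space" "g \<in> L2_space"
  shows "(\<lambda>x. f x + g x) \<in> L2_space"
proof -
  note [measurable] = L2_spaceD(1)[OF assms(1)] L2_spaceD(1)[OF assms(2)]
  have "integrable unit_lborel (\<lambda>x. (f x)\<^sup>2 + (g x)\<^sup>2 + 2 * (f x * g x))"
    by (intro Bochner_Integration.integrable_add integrable_mult_right L2_spaceD L2_mult_integrable assms)
  then show ?thesis
    by (simp add: L2_space_def power2_sum mult.assoc)
qed

lemma L2_diff [intro]:
  assumes "f \<in> L2_space" "g \<in> L2_space"
  shows "(\<lambda>x. f x - g x) \<in> L2_space"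
  using L2_add[OF assms(1) L2_scale[OF assms(2), of "-1"]] by simp

lemma L2_zero [simp, intro]: "(\<lambda>x. 0) \<in> L2_space"
  by (simp add: L2_space_def)

lemma L2_sum [intro]:
  assumes "\<And>j. j \<in> A \<Longrightarrow> f j \<in> L2_space"
  shows "(\<lambda>x. \<Sum>j\<in>A. f j x) \<in> L2_space"
  using assms by (induction A rule: infinite_finite_induct) (auto intro!: L2_add)

lemma L2_bounded:
  assumes [measurable]: "f \<in> borel_measurable unit_lborel"
    and "\<And>x. x \<in> {0<..<1} \<Longrightarrow> \<bar>f x\<bar> \<le> B"
  shows "f \<in> L2_space"
proof -
  have "(f x)\<^sup>2 \<le> B\<^sup>2" if "x \<in> {0<..<1}" for x
    using power_mono[OF assms(2)[OF that], of 2] by simp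
  then have "integrable unit_lborel (\<lambda>x. (f x)\<^sup>2)"
    by (intro unit_lborel.integrable_const_bound[where B="B\<^sup>2"]) auto
  then show ?thesis by (simp add: L2_space_def)
qed

text \<open>Continuity up to the end points makes the function bounded by compactness.\<close>

lemma L2_continuous:
  assumes "continuous_on {0..1} f"
  shows "f \<in> L2_space"
proof -
  have "bounded (f ` {0..1})"
    using assms compact_continuous_image compact_imp_bounded by blast
  then obtain B where "\<And>x. x \<in> {0..1} \<Longrightarrow> \<bar>f x\<bar> \<le> B"
    unfolding bounded_real by blast
  moreover have "f \<in> borel_measurable unit_lborel"
    unfolding unit_lborel_def measurable_cong_sets[OF sets_restrict_space_cong[OF sets_lborel] refl]
    by (intro borel_measurable_continuous_on_restrict continuous_on_subset[OF assms]) auto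
  ultimately show ?thesis
    by (intro L2_bounded[where B=B]) auto
qed

lemma L2_inner_commute: "L2_inner f g = L2_inner g f"
  by (simp add: L2_inner_def mult.commute)

lemma L2_inner_add_left:
  assumes "f \<in> L2_space" "g \<in> L2_space" "h \<in> L2_space"
  shows "L2_inner (\<lambda>x. f x + g x) h = L2_inner f h + L2_inner g h"
  unfolding L2_inner_def using assms by (simp add: L2_mult_integrable distrib_right)

lemma L2_inner_diff_left:
  assumes "f \<in> L2_space" "g \<in> L2_space" "h \<in> L2_space"
  shows "L2_inner (\<lambda>x. f x - g x) h = L2_inner f h - L2_inner g h"
  unfolding L2_inner_def using assms by (simp add: L2_mult_integrable left_diff_distrib)

text \<open>Unlike additivity this holds for all functions, because scalars can be pulled out of the
  integral even when it takes its default value.\<close>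

lemma L2_inner_scale_left: "L2_inner (\<lambda>x. a * f x) h = a * L2_inner f h"
  unfolding L2_inner_def by (simp add: mult.assoc)

lemma L2_inner_add_right:
  assumes "f \<in> L2_space" "g \<in> L2_space" "h \<in> L2_space"
  shows "L2_inner h (\<lambda>x. f x + g x) = L2_inner h f + L2_inner h g"
  using L2_inner_add_left[OF assms] by (simp add: L2_inner_commute)

lemma L2_inner_diff_right:
  assumes "f \<in> L2_space" "g \<in> L2_space" "h \<in> L2_space"
  shows "L2_inner h (\<lambda>x. f x - g x) = L2_inner h f - L2_inner h g"
  using L2_inner_diff_left[OF assms] by (simp add: L2_inner_commute)

lemma L2_inner_scale_right: "L2_inner h (\<lambda>x. a * f x) = a * L2_inner h f"
  using L2_inner_scale_left[of a f h] by (simp add: L2_inner_commute)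

lemma L2_inner_sum_left:
  assumes "\<And>j. j \<in> A \<Longrightarrow> f j \<in> L2_space" "h \<in> L2_space"
  shows "L2_inner (\<lambda>x. \<Sum>j\<in>A. f j x) h = (\<Sum>j\<in>A. L2_inner (f j) h)"
  unfolding L2_inner_def using assms
  by (simp add: L2_mult_integrable sum_distrib_right)

lemma L2_norm_nonneg [simp]: "0 \<le> L2_norm f"
  by (simp add: L2_norm_def)

lemma L2_norm_power2: "(L2_norm f)\<^sup>2 = L2_inner f f"
  by (simp add: L2_norm_def L2_inner_def power2_eq_square)

lemma L2_norm_scale: "L2_norm (\<lambda>x. a * f x) = \<bar>a\<bar> * L2_norm f"
  by (simp add: L2_norm_def power_mult_distrib real_sqrt_mult)

text \<open>A function of norm zero vanishes almost everywhere. This settles the degenerate case of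
  the Cauchy-Schwarz inequality.\<close>

lemma L2_inner_eq_0:
  assumes "f \<in> L2_space" "L2_norm f = 0"
  shows "L2_inner f g = 0"
proof -
  have "AE x in unit_lborel. (f x)\<^sup>2 = 0"
    using assms L2_spaceD[OF assms(1)]
    by (subst integral_nonneg_eq_0_iff_AE[symmetric]) (auto simp: L2_norm_def)
  then show ?thesis
    unfolding L2_inner_def by (intro integral_eq_zero_AE) auto
qed

lemma L2_Cauchy_Schwarz:
  assumes "f \<in> L2_space" "g \<in> L2_space"
  shows "L2_inner f g \<le> L2_norm f * L2_norm g"
proof (cases "L2_norm f = 0 \<or> L2_norm g = 0")
  case True
  then show ?thesis
    using L2_inner_eq_0 L2_inner_commute assms by (metis mult_eq_0_iff order_refl)
next
  case False
  define a b where "a = L2_norm f" and "b = L2_norm g"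
  have ab: "a > 0" "b > 0"
    using False by (auto simp: a_def b_def less_le)
  have aabb: "L2_inner f f = a\<^sup>2" "L2_inner g g = b\<^sup>2"
    by (simp_all add: a_def b_def L2_norm_power2)
  \<comment> \<open>With the norms as weights, both square terms of the expansion equal
    \<open>a\<^sup>2 * b\<^sup>2\<close>, and a factor \<open>a * b\<close> can be
    cancelled.\<close>
  have "0 \<le> L2_inner (\<lambda>x. b * f x - a * g x) (\<lambda>x. b * f x - a * g x)"
    by (simp add: L2_inner_def)
  also have "\<dots> = b\<^sup>2 * a\<^sup>2 + a\<^sup>2 * b\<^sup>2 - 2 * (a * b) * L2_inner f g"
    using assms
    by (simp add: L2_inner_diff_left L2_inner_diff_right L2_inner_scale_left L2_inner_scale_right
        L2_scale L2_diff aabb L2_inner_commute[of g f])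
      (simp add: algebra_simps power2_eq_square)
  finally have "(a * b) * L2_inner f g \<le> (a * b) * (a * b)"
    by (simp add: power2_eq_square algebra_simps)
  then show ?thesis
    using ab by (simp add: a_def b_def mult_le_cancel_left_pos)
qed

lemma L2_norm_triangle:
  assumes "f \<in> L2_space" "g \<in> L2_space"
  shows "L2_norm (\<lambda>x. f x + g x) \<le> L2_norm f + L2_norm g"
proof (rule power2_le_imp_le)
  have "(L2_norm (\<lambda>x. f x + g x))\<^sup>2 = (L2_norm f)\<^sup>2 + (L2_norm g)\<^sup>2 + 2 * L2_inner f g"
    using assms by (simp add: L2_norm_power2 L2_inner_add_left L2_inner_add_right L2_add
        L2_inner_commute[of g f])
  also have "\<dots> \<le> (L2_norm f + L2_norm g)\<^sup>2"
    using L2_Cauchy_Schwarz[OF assms] by (simp add: power2_sum)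
  finally show "(L2_norm (\<lambda>x. f x + g x))\<^sup>2 \<le> (L2_norm f + L2_norm g)\<^sup>2" .
qed simp

lemma L2_norm_diff_commute: "L2_norm (\<lambda>x. f x - g x) = L2_norm (\<lambda>x. g x - f x)"
  by (simp add: L2_norm_def power2_commute)

lemma L2_norm_triangle_sub:
  assumes "f \<in> L2_space" "g \<in> L2_space"
  shows "\<bar>L2_norm f - L2_norm g\<bar> \<le> L2_norm (\<lambda>x. f x - g x)"
  using L2_norm_triangle[OF L2_diff[OF assms] assms(2)]
    L2_norm_triangle[OF L2_diff[OF assms(2,1)] assms(1)]
    L2_norm_diff_commute[of f g] by simp

lemma L2_norm_tendsto:
  assumes "\<And>n. g n \<in> L2_space" "f \<in> L2_space"
    and "(\<lambda>n. L2_norm (\<lambda>x. f x - g n x)) \<longlonglongrightarrow> 0"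
  shows "(\<lambda>n. L2_norm (g n)) \<longlonglongrightarrow> L2_norm f"
proof -
  have "(\<lambda>n. L2_norm (g n) - L2_norm f) \<longlonglongrightarrow> 0"
    using assms L2_norm_triangle_sub[OF assms(1,2)] L2_norm_diff_commute[of f]
    by (intro Lim_null_comparison[OF _ assms(3)]) auto
  then show ?thesis
    by (simp add: LIM_zero_iff)
qed

lemma L2_norm_le_bound:
  assumes "f \<in> L2_space" "\<And>x. x \<in> {0<..<1} \<Longrightarrow> \<bar>f x\<bar> \<le> B" "0 \<le> B"
  shows "L2_norm f \<le> B"
proof -
  have "(f x)\<^sup>2 \<le> B\<^sup>2" if "x \<in> {0<..<1}" for x
    using power_mono[OF assms(2)[OF that], of 2] by simp
  then have "(LINT x|unit_lborel. (f x)\<^sup>2) \<le> B\<^sup>2"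
    by (intro unit_lborel.integral_le_const L2_spaceD(2) assms) auto
  then show ?thesis
    using assms(3) by (simp add: L2_norm_def real_le_lsqrt)
qed

text \<open>Both facts come from pairing with the constant 1, whose norm is 1.\<close>

lemma
  assumes "f \<in> L2_space"
  shows L2_imp_integrable: "integrable unit_lborel f"
    and integral_abs_le_L2_norm: "(LINT x|unit_lborel. \<bar>f x\<bar>) \<le> L2_norm f"
proof -
  have one: "(\<lambda>x. 1) \<in> L2_space" by (intro L2_continuous) auto
  show "integrable unit_lborel f"
    using L2_mult_integrable[OF assms one] by simp
  note [measurable] = L2_spaceD(1)[OF assms]
  have abs: "(\<lambda>x. \<bar>f x\<bar>) \<in> L2_space"
    using L2_spaceD[OF assms] by (simp add: L2_space_def)
  show "(LINT x|unit_lborel. \<bar>f x\<bar>) \<le> L2_norm f"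
    using L2_Cauchy_Schwarz[OF abs one]
    by (simp add: L2_inner_def L2_norm_def unit_lborel.prob_space[unfolded space_unit_lborel])
qed

subsection \<open>Cosine and sine systems\<close>

text \<open>The indicator of \<open>{..x}\<close> is the form in which integrals up to
  \<open>x\<close> occur in \<open>primitive\<close>. On the support of the measure it differs from
  that of \<open>{0..x}\<close> only at the end points 0 and 1.\<close>

lemma integral_unit_lborel_FTC:
  fixes F g :: "real \<Rightarrow> real"
  assumes "\<And>y. (F has_real_derivative g y) (at y)" "continuous_on UNIV g" "x \<in> {0..1}"
  shows "(LINT y|unit_lborel. g y * indicator {..x} y) = F x - F 0"
proof -
  have "(LINT y|unit_lborel. g y * indicator {..x} y) = (LINT y|lborel. indicator {0..x} y *\<^sub>R g y)"
    unfolding integral_unit_lborel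
  proof (rule integral_cong_AE)
    have [measurable]: "g \<in> borel_measurable borel"
      using assms(2) by (rule borel_measurable_continuous_onI)
    show "(\<lambda>y. indicator {0<..<1} y * (g y * indicator {..x} y)) \<in> borel_measurable lborel"
      "(\<lambda>y. indicator {0..x} y *\<^sub>R g y) \<in> borel_measurable lborel"
      by measurable
    show "AE y in lborel. indicator {0<..<1} y * (g y * indicator {..x} y) = indicator {0..x} y *\<^sub>R g y"
      using AE_lborel_singleton[of 0] AE_lborel_singleton[of 1]
      by eventually_elim (use assms(3) in \<open>auto simp: indicator_def\<close>)
  qed
  also have "\<dots> = F x - F 0"
    using assms
    by (intro integral_FTC_atLeastAtMost)
      (auto simp: has_real_derivative_iff_has_vector_derivative
        intro: has_vector_derivative_at_within continuous_on_subset)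
  finally show ?thesis .
qed

lemma integral_unit_lborel_full:
  fixes f :: "real \<Rightarrow> real"
  shows "(LINT y|unit_lborel. f y) = (LINT y|unit_lborel. f y * indicator {..1} y)"
  by (rule Bochner_Integration.integral_cong) auto

lemma cos_has_real_primitive:
  assumes "a \<noteq> 0"
  shows "((\<lambda>y. sin (a * y) / a) has_real_derivative cos (a * y)) (at y)"
  using assms by (auto intro!: derivative_eq_intros)

text \<open>The frequency is an integer because differences \<open>j - k\<close> of indices occur in
  the orthogonality relations.\<close>

lemma integral_cos_int:
  fixes k :: int
  shows "(LINT y|unit_lborel. cos (pi * of_int k * y)) = (if k = 0 then 1 else 0)"
proof (cases "k = 0")
  case True
  then show ?thesis by (simp add: unit_lborel.prob_space[unfolded space_unit_lborel])
next
  case False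
  then have "(LINT y|unit_lborel. cos (pi * of_int k * y) * indicator {..1} y)
     = sin (pi * of_int k * 1) / (pi * of_int k) - sin (pi * of_int k * 0) / (pi * of_int k)"
    by (intro integral_unit_lborel_FTC cos_has_real_primitive) (auto intro!: continuous_intros)
  also have "\<dots> = 0"
    using sin_integer_2pi[of "of_int k / 2"] sin_zero_iff_int2 by (simp add: mult.commute)
  finally show ?thesis
    using False integral_unit_lborel_full[of "\<lambda>y. cos (pi * of_int k * y)"] by simp
qed

text \<open>Integrating \<open>cos_basis j\<close> from 0 gives this function divided by
  \<open>pi * j\<close>.\<close>

definition sin_basis :: "nat \<Rightarrow> real \<Rightarrow> real" where
  "sin_basis j x = sqrt 2 * sin (pi * real j * x)"

lemma L2_cos_basis [simp, intro]: "cos_basis j \<in> L2_space"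
  unfolding cos_basis_def by (intro L2_continuous continuous_intros)

lemma L2_sin_basis [simp, intro]: "sin_basis j \<in> L2_space"
  unfolding sin_basis_def by (intro L2_continuous continuous_intros)

lemma integrable_cos_scale: "integrable unit_lborel (\<lambda>x. cos (a * x))"
  by (intro unit_lborel.integrable_const_bound[where B=1]) auto

lemma sqrt2_mult: "sqrt 2 * a * (sqrt 2 * b) = 2 * (a * b)"
proof -
  have "sqrt 2 * a * (sqrt 2 * b) = (sqrt 2 * sqrt 2) * (a * b)"
    by (simp only: ac_simps)
  then show ?thesis by simp
qed

lemma cos_basis_orthonormal:
  assumes "j \<ge> 1" "k \<ge> 1"
  shows "L2_inner (cos_basis j) (cos_basis k) = (if j = k then 1 else 0)"
proof -
  have "cos_basis j x * cos_basis k x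
      = cos (pi * of_int (int j - int k) * x) + cos (pi * of_int (int j + int k) * x)" for x
    by (simp only: cos_basis_def sqrt2_mult) (simp add: cos_times_cos algebra_simps)
  then show ?thesis
    using assms by (simp add: L2_inner_def integrable_cos_scale integral_cos_int del: of_int_diff of_int_add)
qed

lemma sin_basis_orthonormal:
  assumes "j \<ge> 1" "k \<ge> 1"
  shows "L2_inner (sin_basis j) (sin_basis k) = (if j = k then 1 else 0)"
proof -
  have "sin_basis j x * sin_basis k x
      = cos (pi * of_int (int j - int k) * x) - cos (pi * of_int (int j + int k) * x)" for x
    by (simp only: sin_basis_def sqrt2_mult) (simp add: sin_times_sin diff_divide_distrib algebra_simps)
  then show ?thesis
    using assms by (simp add: L2_inner_def integrable_cos_scale integral_cos_int del: of_int_diff of_int_add)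
qed

text \<open>Pythagoras for an arbitrary orthonormal sequence, so that it serves the cosines and the
  sines alike.\<close>

lemma L2_norm_sum_orthonormal:
  assumes "\<And>j. e j \<in> L2_space"
    and "\<And>j k. j \<ge> 1 \<Longrightarrow> k \<ge> 1 \<Longrightarrow> L2_inner (e j) (e k) = (if j = k then 1 else 0)"
  shows "(L2_norm (\<lambda>x. \<Sum>j=1..N. a j * e j x))\<^sup>2 = (\<Sum>j=1..N::nat. (a j)\<^sup>2)"
proof -
  let ?S = "\<lambda>x. \<Sum>j=1..N. a j * e j x"
  have S: "?S \<in> L2_space"
    using assms(1) by (intro L2_sum L2_scale)
  have 1: "L2_inner (e k) ?S = a k" if "k \<in> {1..N}" for k
    using that assms
    by (subst L2_inner_commute)
      (simp add: L2_inner_sum_left L2_scale L2_inner_scale_left if_distrib[of "\<lambda>x. _ * x"] cong: if_cong)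
  have "L2_inner ?S ?S = (\<Sum>k=1..N. a k * L2_inner (e k) ?S)"
    using assms(1) S by (simp add: L2_inner_sum_left L2_scale L2_inner_scale_left)
  also have "\<dots> = (\<Sum>j=1..N. (a j)\<^sup>2)"
    by (intro sum.cong refl, subst 1) (simp_all add: power2_eq_square)
  finally show ?thesis
    by (simp add: L2_norm_power2)
qed

subsection \<open>Completeness of the cosine system\<close>

lemma L2_clip_tendsto:
  assumes "f \<in> L2_space"
  shows "(\<lambda>k. L2_norm (\<lambda>x. f x - max (- real k) (min (real k) (f x)))) \<longlonglongrightarrow> 0"
proof -
  note [measurable] = L2_spaceD(1)[OF assms]
  have "(\<lambda>k. LINT x|unit_lborel. (f x - max (- real k) (min (real k) (f x)))\<^sup>2) \<longlonglongrightarrow> (LINT x|unit_lborel. 0)"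
  proof (rule integral_dominated_convergence)
    show "integrable unit_lborel (\<lambda>x. (f x)\<^sup>2)" using assms by (rule L2_spaceD)
    show "AE x in unit_lborel. norm ((f x - max (- real k) (min (real k) (f x)))\<^sup>2) \<le> (f x)\<^sup>2" for k
    proof (rule AE_I2)
      fix x
      have "\<bar>f x - max (- real k) (min (real k) (f x))\<bar> \<le> \<bar>f x\<bar>"
        by (auto simp: max_def min_def abs_if)
      then show "norm ((f x - max (- real k) (min (real k) (f x)))\<^sup>2) \<le> (f x)\<^sup>2"
        by (simp add: abs_le_square_iff)
    qed
    show "AE x in unit_lborel. (\<lambda>k. (f x - max (- real k) (min (real k) (f x)))\<^sup>2) \<longlonglongrightarrow> 0"
    proof (rule AE_I2, rule tendsto_eventually)
      fix x
      have "eventually (\<lambda>k. \<bar>f x\<bar> \<le> real k) sequentially"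
        using real_nat_ceiling_ge by (intro eventually_sequentiallyI[of "nat \<lceil>\<bar>f x\<bar>\<rceil>"]) linarith
      then show "eventually (\<lambda>k. (f x - max (- real k) (min (real k) (f x)))\<^sup>2 = 0) sequentially"
        by eventually_elim auto
    qed
  qed measurable
  from tendsto_real_sqrt[OF this] show ?thesis
    by (simp add: L2_norm_def)
qed

text \<open>A measurable function is an almost everywhere limit of continuous functions
  \<open>g n\<close>. These may be unbounded, so \<open>f\<close> and \<open>g n\<close> are both
  truncated at a level \<open>k\<close>; dominated convergence then applies with a constant bound,
  and truncation preserves continuity.\<close>

lemma L2_continuous_dense:
  assumes "f \<in> L2_space" "e > 0"
  obtains h where "continuous_on UNIV h" "L2_norm (\<lambda>x. f x - h x) < e"
proof -
  note [measurable] = L2_spaceD(1)[OF assms(1)]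
  obtain k where k: "L2_norm (\<lambda>x. f x - max (- real k) (min (real k) (f x))) < e / 2"
    using order_tendstoD(2)[OF L2_clip_tendsto[OF assms(1)], of "e / 2"] assms(2)
    by (auto simp: eventually_sequentially)
  define clip where "clip t = max (- real k) (min (real k) t)" for t
  have clip_bound: "\<bar>clip t\<bar> \<le> real k" for t
    by (auto simp: clip_def)
  have clip_cont: "continuous_on UNIV clip"
    unfolding clip_def by (intro continuous_intros)
  then have [measurable]: "clip \<in> borel_measurable borel"
    by (rule borel_measurable_continuous_onI)
  \<comment> \<open>Extension by zero makes \<open>f\<close> a measurable function on the whole
    line, as \<open>measurable_on\<close> requires.\<close>
  have "(\<lambda>x. indicator {0<..<1} x * f x) \<in> borel_measurable lborel"
    using L2_spaceD(1)[OF assms(1)]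
    by (subst (asm) unit_lborel_def, subst (asm) borel_measurable_restrict_space_iff)
      (auto simp: mult.commute)
  then have "(\<lambda>x. indicator {0<..<1} x * f x) measurable_on UNIV"
    by (intro lebesgue_measurable_imp_measurable_on_real measurable_completion) auto
  then obtain Z g where Z: "negligible Z" and g: "\<And>n. continuous_on UNIV (g n)"
    and lim: "\<And>x. x \<notin> Z \<Longrightarrow> (\<lambda>n. g n x) \<longlonglongrightarrow> indicator {0<..<1} x * f x"
    by (auto simp: measurable_on_def)
  have [measurable]: "g n \<in> borel_measurable borel" for n
    using g by (rule borel_measurable_continuous_onI)
  have "AE x in lebesgue. x \<notin> Z"
    using Z by (simp add: negligible_iff_null_sets AE_not_in)
  then have AEZ: "AE x in unit_lborel. x \<notin> Z"
    unfolding AE_unit_lborel_iff by (subst (asm) AE_completion_iff) auto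
  have "(\<lambda>n. LINT x|unit_lborel. (clip (f x) - clip (g n x))\<^sup>2) \<longlonglongrightarrow> (LINT x|unit_lborel. 0)"
  proof (rule integral_dominated_convergence)
    show "integrable unit_lborel (\<lambda>x. (2 * real k)\<^sup>2)" by simp
    show "AE x in unit_lborel. norm ((clip (f x) - clip (g n x))\<^sup>2) \<le> (2 * real k)\<^sup>2" for n
    proof (rule AE_I2)
      fix x
      have "\<bar>clip (f x) - clip (g n x)\<bar> \<le> \<bar>2 * real k\<bar>"
        using clip_bound[of "f x"] clip_bound[of "g n x"] by linarith
      then show "norm ((clip (f x) - clip (g n x))\<^sup>2) \<le> (2 * real k)\<^sup>2"
        by (simp only: abs_le_square_iff real_norm_def abs_power2)
    qed
    show "AE x in unit_lborel. (\<lambda>n. (clip (f x) - clip (g n x))\<^sup>2) \<longlonglongrightarrow> 0"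
      using AEZ AE_space
    proof eventually_elim
      fix x assume x: "x \<notin> Z" "x \<in> space unit_lborel"
      then have "(\<lambda>n. g n x) \<longlonglongrightarrow> f x" using lim[of x] by simp
      then have "(\<lambda>n. clip (g n x)) \<longlonglongrightarrow> clip (f x)"
        using continuous_on_tendsto_compose[OF clip_cont] by simp
      then have "(\<lambda>n. (clip (f x) - clip (g n x))\<^sup>2) \<longlonglongrightarrow> (clip (f x) - clip (f x))\<^sup>2"
        by (intro tendsto_intros)
      then show "(\<lambda>n. (clip (f x) - clip (g n x))\<^sup>2) \<longlonglongrightarrow> 0" by simp
    qed
  qed measurable
  from tendsto_real_sqrt[OF this]
  have lim0: "(\<lambda>n. L2_norm (\<lambda>x. clip (f x) - clip (g n x))) \<longlonglongrightarrow> 0"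
    by (simp add: L2_norm_def)
  obtain n where n: "L2_norm (\<lambda>x. clip (f x) - clip (g n x)) < e / 2"
    using order_tendstoD(2)[OF lim0, of "e / 2"] assms(2) by (auto simp: eventually_sequentially)
  have clipf: "(\<lambda>x. clip (f x)) \<in> L2_space" "(\<lambda>x. clip (g n x)) \<in> L2_space"
    using clip_bound by (auto intro!: L2_bounded[where B="real k"])
  have "L2_norm (\<lambda>x. f x - clip (g n x))
      \<le> L2_norm (\<lambda>x. f x - clip (f x)) + L2_norm (\<lambda>x. clip (f x) - clip (g n x))"
    using L2_norm_triangle[OF L2_diff[OF assms(1) clipf(1)] L2_diff[OF clipf]] by simp
  also have "\<dots> < e" using k n by (simp add: clip_def)
  finally have "L2_norm (\<lambda>x. f x - clip (g n x)) < e" .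
  moreover have "continuous_on UNIV (\<lambda>x. clip (g n x))"
    using continuous_on_compose2[OF clip_cont g] by simp
  ultimately show thesis by (rule that[rotated])
qed

text \<open>A complete orthonormal system must contain the constants; \<open>cos_basis 0\<close> is
  the constant \<open>sqrt 2\<close> and thus not normalized.\<close>

definition cos_sys :: "nat \<Rightarrow> real \<Rightarrow> real" where
  "cos_sys j = (if j = 0 then (\<lambda>x. 1) else cos_basis j)"

definition cos_resid :: "nat \<Rightarrow> (real \<Rightarrow> real) \<Rightarrow> real \<Rightarrow> real" where
  "cos_resid N f x = f x - (\<Sum>j\<le>N. L2_inner f (cos_sys j) * cos_sys j x)"

lemma L2_cos_sys [simp, intro]: "cos_sys j \<in> L2_space"
  by (auto simp: cos_sys_def intro: L2_continuous)

lemma integral_cos_basis: "j \<ge> 1 \<Longrightarrow> (LINT x|unit_lborel. cos_basis j x) = 0"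
  using integral_cos_int[of "int j"] by (simp add: cos_basis_def)

lemma cos_sys_orthonormal: "L2_inner (cos_sys j) (cos_sys k) = (if j = k then 1 else 0)"
  using cos_basis_orthonormal[of j k] integral_cos_basis[of j] integral_cos_basis[of k]
  by (auto simp: cos_sys_def L2_inner_def unit_lborel.prob_space[unfolded space_unit_lborel])

lemma L2_cos_resid: "f \<in> L2_space \<Longrightarrow> cos_resid N f \<in> L2_space"
  unfolding cos_resid_def by (intro L2_diff L2_sum L2_scale L2_cos_sys)

lemma cos_resid_add:
  assumes "f \<in> L2_space" "g \<in> L2_space"
  shows "cos_resid N (\<lambda>x. f x + g x) = (\<lambda>x. cos_resid N f x + cos_resid N g x)"
  using assms by (simp add: cos_resid_def L2_inner_add_left distrib_right sum.distrib fun_eq_iff)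

lemma cos_resid_scale: "cos_resid N (\<lambda>x. a * f x) = (\<lambda>x. a * cos_resid N f x)"
  by (simp add: cos_resid_def L2_inner_scale_left right_diff_distrib sum_distrib_left mult.assoc fun_eq_iff)

text \<open>The residual is what an orthogonal projection leaves over. The bound is uniform in
  \<open>N\<close>, which makes \<open>cos_complete\<close> closed under limits in norm.\<close>

lemma L2_norm_cos_resid_le:
  assumes "f \<in> L2_space"
  shows "L2_norm (cos_resid N f) \<le> L2_norm f"
proof (rule power2_le_imp_le)
  define S where "S x = (\<Sum>j\<le>N. L2_inner f (cos_sys j) * cos_sys j x)" for x
  have S: "S \<in> L2_space" unfolding S_def by (intro L2_sum L2_scale L2_cos_sys)
  have Sh: "L2_inner S h = (\<Sum>j\<le>N. L2_inner f (cos_sys j) * L2_inner (cos_sys j) h)"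
    if "h \<in> L2_space" for h
    unfolding S_def using that by (simp add: L2_inner_sum_left L2_scale L2_inner_scale_left)
  have Se: "L2_inner (cos_sys k) S = L2_inner f (cos_sys k)" if "k \<le> N" for k
    using that by (subst L2_inner_commute)
      (simp add: Sh cos_sys_orthonormal if_distrib[of "\<lambda>x. _ * x"] cong: if_cong)
  \<comment> \<open>This says that \<open>f - S\<close> is orthogonal to \<open>S\<close>.\<close>
  have SS: "L2_inner S S = L2_inner S f"
    using S assms by (subst (1 2) Sh) (auto intro!: sum.cong simp: Se L2_inner_commute[of f])
  have "(L2_norm (cos_resid N f))\<^sup>2 = L2_inner (\<lambda>x. f x - S x) (\<lambda>x. f x - S x)"
    by (simp add: L2_norm_power2 cos_resid_def[abs_def] S_def)
  also have "\<dots> = L2_inner f f - L2_inner S S"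
    using assms S by (simp add: L2_inner_diff_left L2_inner_diff_right L2_diff L2_inner_commute[of f S] SS)
  also have "\<dots> \<le> (L2_norm f)\<^sup>2"
    by (simp add: L2_norm_power2[symmetric])
  finally show "(L2_norm (cos_resid N f))\<^sup>2 \<le> (L2_norm f)\<^sup>2" .
qed simp

text \<open>Completeness of the system means that this set is all of \<open>L2_space\<close>. It is
  obtained by showing that the set is a closed subspace with a dense subset.\<close>

definition cos_complete :: "(real \<Rightarrow> real) set" where
  "cos_complete = {f \<in> L2_space. (\<lambda>N. L2_norm (cos_resid N f)) \<longlonglongrightarrow> 0}"

lemma cos_complete_add:
  assumes "f \<in> cos_complete" "g \<in> cos_complete"
  shows "(\<lambda>x. f x + g x) \<in> cos_complete"
proof -
  have fg: "f \<in> L2_space" "g \<in> L2_space" using assms by (auto simp: cos_complete_def)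
  have lim: "(\<lambda>N. L2_norm (cos_resid N f) + L2_norm (cos_resid N g)) \<longlonglongrightarrow> 0"
    using assms by (auto simp: cos_complete_def intro: tendsto_add_zero)
  have "(\<lambda>N. L2_norm (cos_resid N (\<lambda>x. f x + g x))) \<longlonglongrightarrow> 0"
    using L2_norm_triangle[OF L2_cos_resid[OF fg(1)] L2_cos_resid[OF fg(2)]]
    by (intro Lim_null_comparison[OF always_eventually lim]) (simp add: cos_resid_add[OF fg])
  then show ?thesis using fg by (auto simp: cos_complete_def)
qed

lemma cos_complete_scale:
  assumes "f \<in> cos_complete"
  shows "(\<lambda>x. a * f x) \<in> cos_complete"
  using assms by (auto simp: cos_complete_def cos_resid_scale L2_norm_scale intro: tendsto_mult_right_zero)

lemma cos_complete_sum:
  assumes "\<And>i. i \<in> I \<Longrightarrow> f i \<in> cos_complete"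
  shows "(\<lambda>x. \<Sum>i\<in>I. f i x) \<in> cos_complete"
proof -
  have "(\<lambda>x. 0) \<in> cos_complete"
    by (auto simp: cos_complete_def cos_resid_def L2_inner_def L2_norm_def)
  then show ?thesis
    using assms by (induction I rule: infinite_finite_induct) (auto intro!: cos_complete_add)
qed

lemma cos_complete_closed:
  assumes "f \<in> L2_space" "\<And>e. e > 0 \<Longrightarrow> \<exists>g\<in>cos_complete. L2_norm (\<lambda>x. f x - g x) < e"
  shows "f \<in> cos_complete"
proof -
  have "(\<lambda>N. L2_norm (cos_resid N f)) \<longlonglongrightarrow> 0"
  proof (rule tendstoI)
    fix e :: real assume "e > 0"
    then obtain g where g: "g \<in> cos_complete" "L2_norm (\<lambda>x. f x - g x) < e / 2"
      using assms(2)[of "e / 2"] by auto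
    have gL: "g \<in> L2_space" using g(1) by (simp add: cos_complete_def)
    have "eventually (\<lambda>N. L2_norm (cos_resid N g) < e / 2) sequentially"
      using g(1) \<open>e > 0\<close> order_tendstoD(2)[of "\<lambda>N. L2_norm (cos_resid N g)" 0 sequentially "e / 2"]
      by (auto simp: cos_complete_def)
    then show "eventually (\<lambda>N. dist (L2_norm (cos_resid N f)) 0 < e) sequentially"
    proof eventually_elim
      case (elim N)
      have "L2_norm (cos_resid N (\<lambda>x. (f x - g x) + g x))
          \<le> L2_norm (cos_resid N (\<lambda>x. f x - g x)) + L2_norm (cos_resid N g)"
        unfolding cos_resid_add[OF L2_diff[OF assms(1) gL] gL]
        by (intro L2_norm_triangle L2_cos_resid L2_diff assms gL)
      also have "L2_norm (cos_resid N (\<lambda>x. f x - g x)) \<le> L2_norm (\<lambda>x. f x - g x)"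
        by (intro L2_norm_cos_resid_le L2_diff assms gL)
      finally show ?case using elim g(2) by simp
    qed
  qed
  then show ?thesis using assms(1) by (simp add: cos_complete_def)
qed

lemma cos_complete_cos_sys: "cos_sys k \<in> cos_complete"
proof -
  have "eventually (\<lambda>N. L2_norm (cos_resid N (cos_sys k)) = 0) sequentially"
  proof (rule eventually_sequentiallyI[of k])
    fix N assume "k \<le> N"
    then have "cos_resid N (cos_sys k) = (\<lambda>x. 0)"
      by (simp add: cos_resid_def cos_sys_orthonormal fun_eq_iff if_distrib[of "\<lambda>x. x * _"] cong: if_cong)
    then show "L2_norm (cos_resid N (cos_sys k)) = 0" by (simp add: L2_norm_def)
  qed
  then show ?thesis
    by (auto simp: cos_complete_def intro: tendsto_eventually)
qed

lemma cos_complete_cos: "(\<lambda>x. cos (pi * real k * x)) \<in> cos_complete"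
proof (cases "k = 0")
  case True
  then show ?thesis using cos_complete_cos_sys[of 0] by (simp add: cos_sys_def)
next
  case False
  then show ?thesis
    using cos_complete_scale[OF cos_complete_cos_sys[of k], of "1 / sqrt 2"]
    by (simp add: cos_sys_def cos_basis_def)
qed

text \<open>The extra factor of free frequency \<open>k\<close> makes the induction work: a
  product-to-sum formula trades one power of \<open>cos (pi * x)\<close> for the frequencies
  \<open>k + 1\<close> and \<open>k - 1\<close>.\<close>

lemma cos_complete_cos_power:
  "(\<lambda>x. cos (pi * x) ^ n * cos (pi * real k * x)) \<in> cos_complete"
proof (induction n arbitrary: k)
  case 0
  then show ?case using cos_complete_cos by simp
next
  case (Suc n)
  show ?case
  proof (cases k)
    \<comment> \<open>There is no frequency below 0 here; the spare power itself serves as the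
      cosine of frequency 1.\<close>
    case 0
    then show ?thesis using Suc.IH[of 1] by (simp add: mult.commute)
  next
    case (Suc m)
    have eq: "cos (pi * x) ^ Suc n * cos (pi * real k * x)
        = (1/2) * (cos (pi * x) ^ n * cos (pi * real (Suc k) * x))
        + (1/2) * (cos (pi * x) ^ n * cos (pi * real m * x))" for x
    proof -
      have "cos (pi * x) * cos (pi * real k * x)
          = (1/2) * cos (pi * real (Suc k) * x) + (1/2) * cos (pi * real m * x)"
        by (subst mult.commute) (simp add: Suc cos_times_cos algebra_simps add_divide_distrib)
      moreover have "cos (pi * x) ^ Suc n * cos (pi * real k * x)
          = cos (pi * x) ^ n * (cos (pi * x) * cos (pi * real k * x))"
        by simp
      ultimately show ?thesis by (simp only: distrib_left mult.left_commute)
    qed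
    show ?thesis
      unfolding eq by (intro cos_complete_add cos_complete_scale Suc.IH)
  qed
qed

lemma cos_complete_poly: "(\<lambda>x. poly p (cos (pi * x))) \<in> cos_complete"
  unfolding poly_altdef
  by (intro cos_complete_sum cos_complete_scale) (use cos_complete_cos_power[of _ 0] in simp)

text \<open>These are the hypotheses of the Stone-Weierstrass theorem. Points are separated because
  the cosine is injective on \<open>{0..pi}\<close>.\<close>

lemma poly_cos_ring: "function_ring_on (range (\<lambda>p x. poly p (cos (pi * x)))) {0..1::real}"
proof
  show "continuous_on {0..1} f" if "f \<in> range (\<lambda>p x. poly p (cos (pi * x)))" for f :: "real \<Rightarrow> real"
    using that by (auto intro!: continuous_intros)
  show "(\<lambda>x. f x + g x) \<in> range (\<lambda>p x. poly p (cos (pi * x)))"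
    if "f \<in> range (\<lambda>p x. poly p (cos (pi * x)))" "g \<in> range (\<lambda>p x. poly p (cos (pi * x)))"
    for f g :: "real \<Rightarrow> real"
    using that by (auto simp flip: poly_add)
  show "(\<lambda>x. f x * g x) \<in> range (\<lambda>p x. poly p (cos (pi * x)))"
    if "f \<in> range (\<lambda>p x. poly p (cos (pi * x)))" "g \<in> range (\<lambda>p x. poly p (cos (pi * x)))"
    for f g :: "real \<Rightarrow> real"
    using that by (auto simp flip: poly_mult)
  show "(\<lambda>_. c) \<in> range (\<lambda>p x. poly p (cos (pi * x :: real)))" for c
    by (rule range_eqI[of _ _ "[:c:]"]) simp
  show "\<exists>f\<in>range (\<lambda>p x. poly p (cos (pi * x))). f x \<noteq> f y"
    if "x \<in> {0..1}" "y \<in> {0..1}" "x \<noteq> y" for x y :: real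
  proof (rule bexI[of _ "\<lambda>x. poly [:0, 1:] (cos (pi * x))"])
    have "pi * x \<noteq> pi * y" using that by simp
    then show "poly [:0, 1:] (cos (pi * x)) \<noteq> poly [:0, 1:] (cos (pi * y))"
      using that cos_inj_pi[of "pi * x" "pi * y"] by auto
  qed (rule range_eqI[of _ _ "[:0, 1:]"], rule refl)
qed simp

text \<open>A continuous function approximates \<open>f\<close> in norm, and a polynomial in
  \<open>cos (pi * x)\<close> approximates that function uniformly on the interval, hence also in
  norm.\<close>

lemma L2_space_cos_complete:
  assumes "f \<in> L2_space"
  shows "f \<in> cos_complete"
proof (rule cos_complete_closed[OF assms])
  fix e :: real assume "e > 0"
  obtain h where h: "continuous_on UNIV h" "L2_norm (\<lambda>x. f x - h x) < e / 2"
    using L2_continuous_dense[OF assms, of "e / 2"] \<open>e > 0\<close> by auto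
  interpret function_ring_on "range (\<lambda>p x. poly p (cos (pi * x)))" "{0..1::real}"
    by (rule poly_cos_ring)
  obtain p where p: "\<forall>x\<in>{0..1}. \<bar>h x - poly p (cos (pi * x))\<bar> < e / 2"
    using Stone_Weierstrass_basic[OF continuous_on_subset[OF h(1)], of "e / 2"] \<open>e > 0\<close> by auto
  let ?g = "\<lambda>x. poly p (cos (pi * x))"
  have g: "?g \<in> cos_complete" by (rule cos_complete_poly)
  then have gL: "?g \<in> L2_space" by (simp add: cos_complete_def)
  have hL: "h \<in> L2_space" by (intro L2_continuous continuous_on_subset[OF h(1)]) auto
  have "L2_norm (\<lambda>x. h x - ?g x) \<le> e / 2"
    using p \<open>e > 0\<close> by (intro L2_norm_le_bound L2_diff hL gL) (auto simp: less_imp_le)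
  then have "L2_norm (\<lambda>x. f x - ?g x) < e"
    using h(2) L2_norm_triangle[OF L2_diff[OF assms hL] L2_diff[OF hL gL]] by simp
  with g show "\<exists>g\<in>cos_complete. L2_norm (\<lambda>x. f x - g x) < e" by (intro bexI[of _ ?g])
qed

text \<open>The zero mean kills the coefficient of the constant, so the residual of the complete
  system is the error of the pure cosine expansion.\<close>

lemma L2_expansion_cos_coeffs:
  assumes "f \<in> L2_space" "(LINT x|unit_lborel. f x) = 0"
  shows "L2_expansion f (\<lambda>j. L2_inner f (cos_basis j))"
proof -
  have "cos_resid N f = (\<lambda>x. f x - (\<Sum>j=1..N. L2_inner f (cos_basis j) * cos_basis j x))" for N
  proof
    fix x
    have "(\<Sum>j\<le>N. L2_inner f (cos_sys j) * cos_sys j x)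
        = L2_inner f (cos_sys 0) * cos_sys 0 x + (\<Sum>j=1..N. L2_inner f (cos_sys j) * cos_sys j x)"
      by (simp add: sum.atMost_shift sum.atLeast_Suc_atMost_Suc_shift sum.atLeast1_atMost_eq)
    also have "\<dots> = (\<Sum>j=1..N. L2_inner f (cos_basis j) * cos_basis j x)"
      using assms(2) by (simp add: cos_sys_def L2_inner_def)
    finally show "cos_resid N f x = f x - (\<Sum>j=1..N. L2_inner f (cos_basis j) * cos_basis j x)"
      by (simp add: cos_resid_def)
  qed
  then show ?thesis
    using L2_space_cos_complete[OF assms(1)] by (simp add: cos_complete_def L2_expansion_def)
qed

subsection \<open>The distance of the distribution functions in terms of the coefficients\<close>

text \<open>For a density \<open>1 + f\<close> this is the difference of the c.d.f. and
  \<open>F0\<close> on the unit interval.\<close>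

definition primitive :: "(real \<Rightarrow> real) \<Rightarrow> real \<Rightarrow> real" where
  "primitive f x = (LINT y|unit_lborel. f y * indicator {..x} y)"

lemma integrable_primitive:
  assumes "f \<in> L2_space"
  shows "integrable unit_lborel (\<lambda>y. f y * indicator {..x} y)"
proof (rule Bochner_Integration.integrable_bound)
  note [measurable] = L2_spaceD(1)[OF assms]
  show "(\<lambda>y. f y * indicator {..x} y) \<in> borel_measurable unit_lborel" by measurable
qed (use L2_imp_integrable[OF assms] in \<open>auto simp: indicator_def\<close>)

text \<open>Forming the primitive is thus continuous from the norm of \<open>L2_space\<close> to the
  uniform norm, which justifies termwise integration of expansions.\<close>

lemma abs_primitive_le:
  assumes "f \<in> L2_space"
  shows "\<bar>primitive f x\<bar> \<le> L2_norm f"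
proof -
  have "\<bar>primitive f x\<bar> \<le> (LINT y|unit_lborel. \<bar>f y * indicator {..x} y\<bar>)"
    unfolding primitive_def by (rule integral_abs_bound)
  also have "\<dots> \<le> (LINT y|unit_lborel. \<bar>f y\<bar>)"
    using integrable_primitive[OF assms] L2_imp_integrable[OF assms]
    by (intro integral_mono) (auto simp: indicator_def)
  also have "\<dots> \<le> L2_norm f"
    by (rule integral_abs_le_L2_norm[OF assms])
  finally show ?thesis .
qed

lemma L2_primitive [intro]:
  assumes "f \<in> L2_space"
  shows "primitive f \<in> L2_space"
proof (rule L2_bounded)
  note [measurable] = L2_spaceD(1)[OF assms]
  have [measurable]: "(\<lambda>x. x) \<in> borel_measurable unit_lborel" by measurable
  \<comment> \<open>In this form the integrand is visibly measurable in \<open>x\<close> and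
    \<open>y\<close> jointly.\<close>
  have eq: "primitive f = (\<lambda>x. LINT y|unit_lborel. (if y \<le> x then f y else 0))"
    unfolding primitive_def by (intro ext Bochner_Integration.integral_cong) auto
  show "primitive f \<in> borel_measurable unit_lborel"
    unfolding eq by (rule unit_lborel.borel_measurable_lebesgue_integral) measurable
qed (use abs_primitive_le[OF assms] in auto)

lemma primitive_diff:
  assumes "f \<in> L2_space" "g \<in> L2_space"
  shows "primitive (\<lambda>x. f x - g x) x = primitive f x - primitive g x"
  using assms by (simp add: primitive_def integrable_primitive left_diff_distrib)

lemma primitive_sum_cos:
  assumes "x \<in> {0..1}"
  shows "primitive (\<lambda>x. \<Sum>j=1..N. \<theta> j * cos_basis j x) x
       = (\<Sum>j=1..N. \<theta> j / (pi * real j) * sin_basis j x)"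
proof -
  have "primitive (cos_basis j) x = sin_basis j x / (pi * real j)" if "j \<ge> 1" for j
  proof -
    have "primitive (cos_basis j) x = sqrt 2 * (sin (pi * real j * x) / (pi * real j))
        - sqrt 2 * (sin (pi * real j * 0) / (pi * real j))"
      unfolding primitive_def cos_basis_def using that assms
      by (intro integral_unit_lborel_FTC DERIV_cmult cos_has_real_primitive) (auto intro!: continuous_intros)
    then show ?thesis by (simp add: sin_basis_def)
  qed
  moreover have "primitive (\<lambda>x. \<Sum>j=1..N. \<theta> j * cos_basis j x) x
      = (\<Sum>j=1..N. \<theta> j * primitive (cos_basis j) x)"
    unfolding primitive_def
    by (simp add: sum_distrib_right mult.assoc integrable_primitive)
  ultimately show ?thesis by simp
qed

lemma L2_norm_cong:
  assumes "\<And>x. x \<in> {0<..<1} \<Longrightarrow> f x = g x"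
  shows "L2_norm f = L2_norm g"
  unfolding L2_norm_def using assms by (auto intro!: Bochner_Integration.integral_cong)

text \<open>Parseval's identity for any expansion. The coefficients are not assumed to be inner
  products, since \<open>besov_ball\<close> only asserts that some \<open>\<theta>\<close>
  exists.\<close>

lemma L2_expansion_norm:
  assumes "f \<in> L2_space" "L2_expansion f \<theta>"
  shows "(\<lambda>N. \<Sum>j=1..N. (\<theta> j)\<^sup>2) \<longlonglongrightarrow> (L2_norm f)\<^sup>2"
proof -
  have "(\<lambda>N. L2_norm (\<lambda>x. \<Sum>j=1..N. \<theta> j * cos_basis j x)) \<longlonglongrightarrow> L2_norm f"
    using assms by (intro L2_norm_tendsto L2_sum L2_scale L2_cos_basis) (auto simp: L2_expansion_def)
  then have "(\<lambda>N. (L2_norm (\<lambda>x. \<Sum>j=1..N. \<theta> j * cos_basis j x))\<^sup>2) \<longlonglongrightarrow> (L2_norm f)\<^sup>2"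
    by (rule tendsto_power)
  then show ?thesis
    by (simp only: L2_norm_sum_orthonormal[OF L2_cos_basis cos_basis_orthonormal])
qed

text \<open>The primitives of the partial sums converge in norm to the primitive of
  \<open>f\<close>, and they are finite sums over the orthonormal sines.\<close>

lemma L2_expansion_primitive_norm:
  assumes "f \<in> L2_space" "L2_expansion f \<theta>"
  shows "(\<lambda>N. \<Sum>j=1..N. (\<theta> j / (pi * real j))\<^sup>2) \<longlonglongrightarrow> (L2_norm (primitive f))\<^sup>2"
proof -
  let ?S = "\<lambda>N x. \<Sum>j=1..N. \<theta> j * cos_basis j x"
  have S: "?S N \<in> L2_space" for N by (intro L2_sum L2_scale L2_cos_basis)
  have "(\<lambda>N. L2_norm (primitive (?S N))) \<longlonglongrightarrow> L2_norm (primitive f)"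
  proof (rule L2_norm_tendsto)
    show "(\<lambda>N. L2_norm (\<lambda>x. primitive f x - primitive (?S N) x)) \<longlonglongrightarrow> 0"
    proof (rule Lim_null_comparison)
      show "(\<lambda>N. L2_norm (\<lambda>x. f x - ?S N x)) \<longlonglongrightarrow> 0"
        using assms(2) by (simp add: L2_expansion_def)
      have "L2_norm (primitive (\<lambda>x. f x - ?S N x)) \<le> L2_norm (\<lambda>x. f x - ?S N x)" for N
        using abs_primitive_le[OF L2_diff[OF assms(1) S]]
        by (intro L2_norm_le_bound L2_primitive L2_diff assms(1) S) auto
      moreover have "primitive (\<lambda>x. f x - ?S N x) = (\<lambda>x. primitive f x - primitive (?S N) x)" for N
        by (rule ext) (rule primitive_diff[OF assms(1) S])
      ultimately show "eventually (\<lambda>N. norm (L2_norm (\<lambda>x. primitive f x - primitive (?S N) x))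
          \<le> L2_norm (\<lambda>x. f x - ?S N x)) sequentially"
        by simp
    qed
  qed (use assms(1) S in auto)
  moreover have "L2_norm (primitive (?S N))
      = L2_norm (\<lambda>x. \<Sum>j=1..N. \<theta> j / (pi * real j) * sin_basis j x)" for N
    by (intro L2_norm_cong primitive_sum_cos) auto
  ultimately have "(\<lambda>N. (L2_norm (\<lambda>x. \<Sum>j=1..N. \<theta> j / (pi * real j) * sin_basis j x))\<^sup>2)
      \<longlonglongrightarrow> (L2_norm (primitive f))\<^sup>2"
    by (intro tendsto_power) simp
  then show ?thesis
    by (simp only: L2_norm_sum_orthonormal[OF L2_sin_basis sin_basis_orthonormal])
qed

text \<open>Nonnegativity of \<open>1 + f\<close> ensures that \<open>ennreal\<close> cuts nothing
  off, so the measure of \<open>{..x}\<close> is an ordinary integral.\<close>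

lemma pert_cdf_eq_primitive:
  assumes "f \<in> L2_space" "AE x in unit_lborel. 1 + f x \<ge> 0" "x \<in> {0<..<1}"
  shows "pert_cdf f x = x + primitive f x"
proof -
  note [measurable] = L2_spaceD(1)[OF assms(1)]
  have [measurable]: "(\<lambda>x. ennreal (1 + f x) * indicator {0<..<1} x) \<in> borel_measurable lborel"
    by (subst borel_measurable_restrict_space_iff_ennreal[symmetric]) (auto simp flip: unit_lborel_def)
  have one: "(\<lambda>x. 1) \<in> L2_space" by (intro L2_continuous) auto
  have int: "integrable unit_lborel (\<lambda>y. (1 + f y) * indicator {..x} y)"
    by (intro integrable_primitive L2_add one assms)
  have "emeasure (density lborel (\<lambda>x. ennreal (1 + f x) * indicator {0<..<1} x)) {..x}
      = (\<integral>\<^sup>+y. (ennreal (1 + f y) * indicator {..x} y) * indicator {0<..<1} y \<partial>lborel)"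
    by (subst emeasure_density) (auto simp: ac_simps)
  also have "\<dots> = (\<integral>\<^sup>+y. ennreal (1 + f y) * indicator {..x} y \<partial>unit_lborel)"
    unfolding unit_lborel_def by (subst nn_integral_restrict_space) auto
  also have "\<dots> = (\<integral>\<^sup>+y. ennreal ((1 + f y) * indicator {..x} y) \<partial>unit_lborel)"
    by (intro nn_integral_cong) (auto simp: indicator_def)
  also have "\<dots> = ennreal (LINT y|unit_lborel. (1 + f y) * indicator {..x} y)"
    by (intro nn_integral_eq_integral int) (use assms(2) in eventually_elim, auto simp: indicator_def)
  finally have "pert_cdf f x = (LINT y|unit_lborel. (1 + f y) * indicator {..x} y)"
    using assms(2) unfolding pert_cdf_def cdf_def measure_def
    by (subst enn2real_ennreal[symmetric]) (auto intro!: integral_nonneg_AE)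
  also have "\<dots> = (LINT y|unit_lborel. 1 * indicator {..x} y) + primitive f x"
    unfolding primitive_def using integrable_primitive[OF one, of x] integrable_primitive[OF assms(1), of x]
    by (simp add: distrib_right)
  also have "(LINT y|unit_lborel. 1 * indicator {..x} y) = x"
    using integral_unit_lborel_FTC[of "\<lambda>x. x" "\<lambda>_. 1" x] assms(3) by simp
  finally show ?thesis .
qed

lemma cvm_T_eq_L2_norm_primitive:
  assumes "f \<in> L2_space" "AE x in unit_lborel. 1 + f x \<ge> 0"
  shows "cvm_T (\<lambda>x. pert_cdf f x - F0 x) = L2_norm (primitive f)"
proof -
  have "cvm_T (\<lambda>x. pert_cdf f x - F0 x) = L2_norm (\<lambda>x. pert_cdf f x - F0 x)"
    by (simp add: cvm_T_def L2_norm_def)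
  also have "\<dots> = L2_norm (primitive f)"
    using pert_cdf_eq_primitive[OF assms] by (intro L2_norm_cong) (simp add: F0_def)
  finally show ?thesis .
qed

subsection \<open>Coefficient tails and Besov balls\<close>

lemma L2_expansion_has_sum:
  assumes "f \<in> L2_space" "L2_expansion f \<theta>"
  shows "((\<lambda>j. (\<theta> j)\<^sup>2) has_sum (L2_norm f)\<^sup>2) {0<..}"
proof -
  \<comment> \<open>The expansion does not constrain \<open>\<theta> 0\<close>, so this term is
    replaced by 0 before passing to a series over all naturals.\<close>
  have "(\<Sum>j\<le>N. if j = 0 then 0 else (\<theta> j)\<^sup>2) = (\<Sum>j=1..N. (\<theta> j)\<^sup>2)" for N
    by (intro sum.mono_neutral_cong_right) auto
  then have "(\<lambda>j. if j = 0 then 0 else (\<theta> j)\<^sup>2) sums (L2_norm f)\<^sup>2"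
    using L2_expansion_norm[OF assms] by (simp add: sums_def_le)
  then have "((\<lambda>j. if j = 0 then 0 else (\<theta> j)\<^sup>2) has_sum (L2_norm f)\<^sup>2) UNIV"
    by (intro sums_nonneg_imp_has_sum) auto
  then show ?thesis
    by (rule has_sum_cong_neutral[THEN iffD1, rotated -1]) auto
qed

text \<open>From \<open>N = m\<close> on, both expansions have the same error. Facts about whole
  expansions thereby carry over to tails.\<close>

lemma L2_expansion_remainder:
  assumes "L2_expansion f \<theta>"
  shows "L2_expansion (\<lambda>x. f x - (\<Sum>j=1..m. \<theta> j * cos_basis j x)) (\<lambda>j. if j \<le> m then 0 else \<theta> j)"
proof -
  have "eventually (\<lambda>N. L2_norm (\<lambda>x. f x - (\<Sum>j=1..N. \<theta> j * cos_basis j x)) =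
    L2_norm (\<lambda>x. f x - (\<Sum>j=1..m. \<theta> j * cos_basis j x)
      - (\<Sum>j=1..N. (if j \<le> m then 0 else \<theta> j) * cos_basis j x))) sequentially"
  proof (rule eventually_sequentiallyI[of m])
    fix N assume "m \<le> N"
    have "(\<Sum>j=1..N. \<theta> j * cos_basis j x) = (\<Sum>j=1..m. \<theta> j * cos_basis j x)
        + (\<Sum>j=1..N. (if j \<le> m then 0 else \<theta> j) * cos_basis j x)" for x
    proof -
      have "(\<Sum>j=1..m. \<theta> j * cos_basis j x) = (\<Sum>j=1..N. (if j \<le> m then \<theta> j * cos_basis j x else 0))"
        using \<open>m \<le> N\<close> by (intro sum.mono_neutral_cong_left) auto
      then show ?thesis
        by (auto simp flip: sum.distrib intro!: sum.cong)
    qed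
    then show "L2_norm (\<lambda>x. f x - (\<Sum>j=1..N. \<theta> j * cos_basis j x)) =
      L2_norm (\<lambda>x. f x - (\<Sum>j=1..m. \<theta> j * cos_basis j x)
        - (\<Sum>j=1..N. (if j \<le> m then 0 else \<theta> j) * cos_basis j x))"
      by (simp add: diff_diff_eq)
  qed
  then show ?thesis
    using assms unfolding L2_expansion_def by (rule tendsto_cong[THEN iffD1])
qed

lemma L2_expansion_tail_has_sum:
  assumes "f \<in> L2_space" "L2_expansion f \<theta>"
  shows "((\<lambda>j. (\<theta> j)\<^sup>2) has_sum (L2_norm (\<lambda>x. f x - (\<Sum>j=1..m. \<theta> j * cos_basis j x)))\<^sup>2) {m<..}"
proof -
  have "((\<lambda>j. (if j \<le> m then 0 else \<theta> j)\<^sup>2) has_sum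
      (L2_norm (\<lambda>x. f x - (\<Sum>j=1..m. \<theta> j * cos_basis j x)))\<^sup>2) {0<..}"
    by (intro L2_expansion_has_sum L2_expansion_remainder assms L2_diff L2_sum L2_scale L2_cos_basis)
  then show ?thesis
    by (rule has_sum_cong_neutral[THEN iffD1, rotated -1]) auto
qed

text \<open>Reduces the real cut-off of the ball to an integer one. For \<open>l < 1\<close> the
  tail starts at index 1.\<close>

lemma nat_floor_tail:
  fixes l :: real
  assumes "l > 0"
  shows "{j. l < real j} = {nat \<lfloor>l\<rfloor><..}"
  using assms by (auto simp: nat_less_iff) linarith+

lemma L2_expansion_tail_summable:
  assumes "f \<in> L2_space" "L2_expansion f \<theta>" "l > 0"
  shows "(\<lambda>j. (\<theta> j)\<^sup>2) summable_on {j. l < real j}"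
  unfolding nat_floor_tail[OF assms(3)]
  using L2_expansion_tail_has_sum[OF assms(1,2)] by (rule has_sum_imp_summable)

lemma L2_expansion_tail_infsum:
  assumes "f \<in> L2_space" "L2_expansion f \<theta>" "l > 0"
  shows "(\<Sum>\<^sub>\<infinity>j\<in>{j. l < real j}. (\<theta> j)\<^sup>2)
    = (L2_norm (\<lambda>x. f x - (\<Sum>j=1..nat \<lfloor>l\<rfloor>. \<theta> j * cos_basis j x)))\<^sup>2"
  unfolding nat_floor_tail[OF assms(3)]
  using L2_expansion_tail_has_sum[OF assms(1,2)] by (rule infsumI)

lemma L2_expansion_norm_split:
  assumes "f \<in> L2_space" "L2_expansion f \<theta>"
  shows "(L2_norm f)\<^sup>2 = (\<Sum>j=1..m. (\<theta> j)\<^sup>2)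
    + (L2_norm (\<lambda>x. f x - (\<Sum>j=1..m. \<theta> j * cos_basis j x)))\<^sup>2"
proof -
  have "((\<lambda>j. (\<theta> j)\<^sup>2) has_sum (\<Sum>j=1..m. (\<theta> j)\<^sup>2)
    + (L2_norm (\<lambda>x. f x - (\<Sum>j=1..m. \<theta> j * cos_basis j x)))\<^sup>2) ({1..m} \<union> {m<..})"
    by (intro has_sum_Un_disjoint has_sum_finite L2_expansion_tail_has_sum assms) auto
  moreover have "{1..m} \<union> {m<..} = {0<..}" by auto
  ultimately show ?thesis
    using has_sum_unique[OF L2_expansion_has_sum[OF assms]] by (simp only:)
qed

text \<open>Replaces the supremum in the extended reals by real inequalities; for negative
  \<open>P\<close> the value \<open>ennreal P\<close> would be 0.\<close>

lemma besov_ball_iff: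
  assumes "P \<ge> 0"
  shows "f \<in> besov_ball s P \<longleftrightarrow> f \<in> L2_space \<and> (\<exists>\<theta>. L2_expansion f \<theta> \<and>
    (\<forall>l>0. l powr (2 * s) * (\<Sum>\<^sub>\<infinity>j\<in>{j. l < real j}. (\<theta> j)\<^sup>2) \<le> P))"
  using assms by (simp add: besov_ball_def SUP_le_iff Ball_def)

lemma L2_expansion_lincomb:
  assumes "f \<in> L2_space" "g \<in> L2_space" "L2_expansion f \<theta>" "L2_expansion g \<eta>"
  shows "L2_expansion (\<lambda>x. u * f x + v * g x) (\<lambda>j. u * \<theta> j + v * \<eta> j)"
proof -
  let ?S = "\<lambda>\<theta> N x. \<Sum>j=1..N. \<theta> j * cos_basis j x"
  have S: "(\<lambda>x. f x - ?S \<theta> N x) \<in> L2_space" "(\<lambda>x. g x - ?S \<eta> N x) \<in> L2_space" for N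
    by (intro L2_diff assms L2_sum L2_scale L2_cos_basis)+
  have eq: "(\<lambda>x. u * f x + v * g x - ?S (\<lambda>j. u * \<theta> j + v * \<eta> j) N x)
      = (\<lambda>x. u * (f x - ?S \<theta> N x) + v * (g x - ?S \<eta> N x))" for N
    by (simp add: algebra_simps sum.distrib sum_distrib_left)
  have le: "L2_norm (\<lambda>x. u * f x + v * g x - ?S (\<lambda>j. u * \<theta> j + v * \<eta> j) N x)
      \<le> \<bar>u\<bar> * L2_norm (\<lambda>x. f x - ?S \<theta> N x) + \<bar>v\<bar> * L2_norm (\<lambda>x. g x - ?S \<eta> N x)" for N
    unfolding eq using L2_norm_triangle[OF L2_scale[OF S(1), of u] L2_scale[OF S(2), of v]]
    by (simp only: L2_norm_scale)
  have lim: "(\<lambda>N. \<bar>u\<bar> * L2_norm (\<lambda>x. f x - ?S \<theta> N x) + \<bar>v\<bar> * L2_norm (\<lambda>x. g x - ?S \<eta> N x)) \<longlonglongrightarrow> 0"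
    using assms(3,4) unfolding L2_expansion_def
    by (intro tendsto_add_zero tendsto_mult_right_zero)
  show ?thesis
    unfolding L2_expansion_def by (rule Lim_null_comparison[OF always_eventually lim]) (use le in simp)
qed

lemma convex_comb_square_le:
  fixes a b u v :: real
  assumes "u \<ge> 0" "v \<ge> 0" "u + v = 1"
  shows "(u * a + v * b)\<^sup>2 \<le> u * a\<^sup>2 + v * b\<^sup>2"
proof -
  have "u * a\<^sup>2 + v * b\<^sup>2 - (u * a + v * b)\<^sup>2 = u * v * (a - b)\<^sup>2"
  proof -
    have v: "v = 1 - u" using assms by simp
    show ?thesis unfolding v by (simp add: power2_eq_square algebra_simps)
  qed
  then show ?thesis using assms by (smt (verit) mult_nonneg_nonneg zero_le_power2)
qed

text \<open>Coefficients combine linearly and squaring is convex, so each weighted tail of the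
  combination is at most the convex combination of the two given tails.\<close>

lemma convex_besov_ball:
  assumes "P \<ge> 0"
  shows "convex_fun_set (besov_ball s P)"
  unfolding convex_fun_set_def
proof (intro ballI allI impI)
  fix g h u v assume "g \<in> besov_ball s P" "h \<in> besov_ball s P"
    and uv: "0 \<le> u" "0 \<le> v" "u + v = (1::real)"
  then obtain \<theta> \<eta> where gh: "g \<in> L2_space" "h \<in> L2_space" "L2_expansion g \<theta>" "L2_expansion h \<eta>"
    and tail: "\<And>l. l > 0 \<Longrightarrow> l powr (2 * s) * (\<Sum>\<^sub>\<infinity>j\<in>{j. l < real j}. (\<theta> j)\<^sup>2) \<le> P"
      "\<And>l. l > 0 \<Longrightarrow> l powr (2 * s) * (\<Sum>\<^sub>\<infinity>j\<in>{j. l < real j}. (\<eta> j)\<^sup>2) \<le> P"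
    using assms by (auto simp: besov_ball_iff)
  let ?f = "\<lambda>x. u * g x + v * h x" and ?\<zeta> = "\<lambda>j. u * \<theta> j + v * \<eta> j"
  have f: "?f \<in> L2_space" "L2_expansion ?f ?\<zeta>"
    using gh by (auto intro: L2_expansion_lincomb)
  have "l powr (2 * s) * (\<Sum>\<^sub>\<infinity>j\<in>{j. l < real j}. (?\<zeta> j)\<^sup>2) \<le> P" if l: "l > 0" for l
  proof -
    let ?A = "{j. l < real j}"
    have sm: "(\<lambda>j. (\<theta> j)\<^sup>2) summable_on ?A" "(\<lambda>j. (\<eta> j)\<^sup>2) summable_on ?A"
      using L2_expansion_tail_summable gh l by auto
    have "(\<Sum>\<^sub>\<infinity>j\<in>?A. (?\<zeta> j)\<^sup>2) \<le> (\<Sum>\<^sub>\<infinity>j\<in>?A. u * (\<theta> j)\<^sup>2 + v * (\<eta> j)\<^sup>2)"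
      using uv by (intro infsum_mono L2_expansion_tail_summable[OF f l] summable_on_add
          summable_on_cmult_right sm convex_comb_square_le)
    also have "\<dots> = u * (\<Sum>\<^sub>\<infinity>j\<in>?A. (\<theta> j)\<^sup>2) + v * (\<Sum>\<^sub>\<infinity>j\<in>?A. (\<eta> j)\<^sup>2)"
      by (simp add: infsum_add infsum_cmult_right sm summable_on_cmult_right)
    finally have "l powr (2 * s) * (\<Sum>\<^sub>\<infinity>j\<in>?A. (?\<zeta> j)\<^sup>2)
        \<le> u * (l powr (2 * s) * (\<Sum>\<^sub>\<infinity>j\<in>?A. (\<theta> j)\<^sup>2))
          + v * (l powr (2 * s) * (\<Sum>\<^sub>\<infinity>j\<in>?A. (\<eta> j)\<^sup>2))"
      using mult_left_mono[of _ _ "l powr (2 * s)"] by (fastforce simp: algebra_simps)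
    also have "\<dots> \<le> P"
      using convex_bound_le[OF tail(1)[OF l] tail(2)[OF l] uv] by simp
    finally show ?thesis .
  qed
  with f show "?f \<in> besov_ball s P"
    using assms by (auto simp: besov_ball_iff)
qed

text \<open>Tails scale with the square of the factor, hence the square root. Used in the
  contrapositive: outside all multiples of the ball the weighted tails exceed every bound.\<close>

lemma in_scaled_besov_ball:
  assumes "f \<in> L2_space" "L2_expansion f \<theta>" "P > 0" "K > 0"
    and "\<And>l. l > 0 \<Longrightarrow> l powr (2 * s) * (\<Sum>\<^sub>\<infinity>j\<in>{j. l < real j}. (\<theta> j)\<^sup>2) \<le> K"
  shows "f \<in> scaled_set (sqrt (K / P)) (besov_ball s P)"
proof -
  define a where "a = sqrt (P / K)"
  have a: "a\<^sup>2 = P / K" "a > 0" using assms(3,4) by (auto simp: a_def)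
  have "L2_expansion (\<lambda>x. a * f x) (\<lambda>j. a * \<theta> j)"
    using L2_expansion_lincomb[OF assms(1,1,2,2), of a 0] by simp
  moreover have "l powr (2 * s) * (\<Sum>\<^sub>\<infinity>j\<in>{j. l < real j}. (a * \<theta> j)\<^sup>2) \<le> P" if "l > 0" for l
  proof -
    have "l powr (2 * s) * (\<Sum>\<^sub>\<infinity>j\<in>{j. l < real j}. (a * \<theta> j)\<^sup>2)
        = (P / K) * (l powr (2 * s) * (\<Sum>\<^sub>\<infinity>j\<in>{j. l < real j}. (\<theta> j)\<^sup>2))"
      by (simp only: power_mult_distrib infsum_cmult_right' a mult.left_commute)
    also have "\<dots> \<le> (P / K) * K"
      using assms(3,4) by (intro mult_left_mono assms(5) that) auto
    finally show ?thesis using assms(4) by simp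
  qed
  ultimately have "(\<lambda>x. a * f x) \<in> besov_ball s P"
    using assms(1,3) by (auto simp: besov_ball_iff)
  moreover have "f = (\<lambda>x. sqrt (K / P) * (a * f x))"
    using assms(3,4) by (simp add: a_def real_sqrt_divide)
  ultimately show ?thesis
    unfolding scaled_set_def by (intro image_eqI[of _ _ "\<lambda>x. a * f x"])
qed

text \<open>Integration divides the coefficients up to \<open>l\<close> by at most
  \<open>pi * l\<close>; the others are dropped.\<close>

lemma L2_norm_primitive_ge:
  assumes "f \<in> L2_space" "L2_expansion f \<theta>" "l > 0"
  shows "(\<Sum>j=1..nat \<lfloor>l\<rfloor>. (\<theta> j)\<^sup>2) / (pi * l)\<^sup>2 \<le> (L2_norm (primitive f))\<^sup>2"
proof (rule LIMSEQ_le_const[OF L2_expansion_primitive_norm[OF assms(1,2)]], intro exI allI impI)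
  fix N assume "nat \<lfloor>l\<rfloor> \<le> N"
  have "(\<Sum>j=1..nat \<lfloor>l\<rfloor>. (\<theta> j)\<^sup>2) / (pi * l)\<^sup>2 = (\<Sum>j=1..nat \<lfloor>l\<rfloor>. (\<theta> j)\<^sup>2 / (pi * l)\<^sup>2)"
    by (rule sum_divide_distrib)
  also have "\<dots> \<le> (\<Sum>j=1..nat \<lfloor>l\<rfloor>. (\<theta> j / (pi * real j))\<^sup>2)"
  proof (rule sum_mono)
    fix j assume "j \<in> {1..nat \<lfloor>l\<rfloor>}"
    then have "1 \<le> real j" "real j \<le> l" using assms(3) by (auto simp: le_nat_floor) linarith
    then show "(\<theta> j)\<^sup>2 / (pi * l)\<^sup>2 \<le> (\<theta> j / (pi * real j))\<^sup>2"
      unfolding power_divide by (intro divide_left_mono power_mono mult_left_mono) auto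
  qed
  also have "\<dots> \<le> (\<Sum>j=1..N. (\<theta> j / (pi * real j))\<^sup>2)"
    using \<open>nat \<lfloor>l\<rfloor> \<le> N\<close> by (intro sum_mono2) auto
  finally show "(\<Sum>j=1..nat \<lfloor>l\<rfloor>. (\<theta> j)\<^sup>2) / (pi * l)\<^sup>2 \<le> (\<Sum>j=1..N. (\<theta> j / (pi * real j))\<^sup>2)" .
qed

text \<open>Only coefficients beyond \<open>m\<close> survive, and integration divides these by more
  than \<open>pi * m\<close>.\<close>

lemma L2_norm_primitive_le:
  assumes "f \<in> L2_space" "L2_expansion f \<theta>" "\<And>j. j \<le> m \<Longrightarrow> \<theta> j = 0" "m > 0"
  shows "L2_norm (primitive f) \<le> L2_norm f / (pi * real m)"
proof (rule power2_le_imp_le)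
  have "(L2_norm (primitive f))\<^sup>2 \<le> (L2_norm f)\<^sup>2 / (pi * real m)\<^sup>2"
  proof (rule LIMSEQ_le[OF L2_expansion_primitive_norm[OF assms(1,2)]
        tendsto_divide[OF L2_expansion_norm[OF assms(1,2)] tendsto_const]], goal_cases)
    case 2
    have "(\<theta> j / (pi * real j))\<^sup>2 \<le> (\<theta> j)\<^sup>2 / (pi * real m)\<^sup>2" for j
    proof (cases "j \<le> m")
      case False
      then show ?thesis
        unfolding power_divide using assms(4) by (intro divide_left_mono power_mono mult_left_mono) auto
    qed (simp add: assms(3))
    then show ?case
      by (intro exI[of _ 0] allI impI) (simp add: sum_divide_distrib sum_mono)
  qed (use assms(4) in simp)
  then show "(L2_norm (primitive f))\<^sup>2 \<le> (L2_norm f / (pi * real m))\<^sup>2"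
    by (simp add: power_divide)
qed simp

subsection \<open>The two halves of the maxiset property\<close>

lemma besov_ball_primitive_lower_bound:
  fixes r s P c :: real and n :: nat
  assumes "s > 0" "P > 0" "c > 0" "n \<ge> 1" and rs: "2 * r + 2 * r / s = 1"
    and "f \<in> besov_ball s P" and lower: "c * real n powr (- r) < L2_norm f"
  shows "c\<^sup>2 / (2 * pi\<^sup>2 * (2 * P / c\<^sup>2) powr (1 / s)) \<le> real n * (L2_norm (primitive f))\<^sup>2"
proof -
  obtain \<theta> where f: "f \<in> L2_space" "L2_expansion f \<theta>"
    and tail: "\<And>l. l > 0 \<Longrightarrow> l powr (2 * s) * (\<Sum>\<^sub>\<infinity>j\<in>{j. l < real j}. (\<theta> j)\<^sup>2) \<le> P"
    using assms by (auto simp: besov_ball_iff)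
  \<comment> \<open>The cut-off is chosen so that \<open>l powr (2 * s)\<close> is
    \<open>2 * P / c\<^sup>2\<close> times \<open>n powr (2 * r)\<close>; the ball condition then
    bounds the tail by half of the squared lower bound for the norm.\<close>
  define q where "q = 2 * P / c\<^sup>2"
  define l where "l = q powr (1 / (2 * s)) * real n powr (r / s)"
  have q: "q > 0" using assms by (simp add: q_def)
  have n: "real n > 0" using assms by simp
  have l: "l > 0" using q n by (simp add: l_def)
  have l2s: "l powr (2 * s) = q * real n powr (2 * r)"
    using assms q by (simp add: l_def powr_mult powr_powr mult.commute)
  have l2: "l\<^sup>2 = q powr (1 / s) * real n powr (2 * r / s)"
    using assms q by (simp add: l_def power_mult_distrib flip: powr_realpow add: powr_powr mult.commute)
  have nr: "(real n powr (- r))\<^sup>2 = 1 / real n powr (2 * r)"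
    using n by (simp add: powr_minus_divide power_divide flip: powr_realpow add: powr_powr mult.commute)
  define E where "E = 1 / real n powr (2 * r)"
  let ?m = "nat \<lfloor>l\<rfloor>"
  let ?R = "L2_norm (\<lambda>x. f x - (\<Sum>j=1..?m. \<theta> j * cos_basis j x))"
  have "q * real n powr (2 * r) * ?R\<^sup>2 \<le> P"
    using tail[OF l] by (simp only: L2_expansion_tail_infsum[OF f l] l2s)
  then have "?R\<^sup>2 \<le> c\<^sup>2 / 2 * E"
    using assms q n by (simp add: q_def E_def field_simps)
  moreover have "c\<^sup>2 * E \<le> (L2_norm f)\<^sup>2"
    using power_mono[OF less_imp_le[OF lower], of 2] assms nr by (simp add: power_mult_distrib E_def)
  ultimately have sum: "c\<^sup>2 / 2 * E \<le> (\<Sum>j=1..?m. (\<theta> j)\<^sup>2)"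
    using L2_expansion_norm_split[OF f, of ?m] by simp
  have "real n powr (2 * r) * real n powr (2 * r / s) = real n"
    \<comment> \<open>By the relation between \<open>r\<close> and \<open>s\<close>, all powers of
      \<open>n\<close> cancel in the final bound.\<close>
    using n rs by (simp flip: powr_add)
  then have "c\<^sup>2 / (2 * pi\<^sup>2 * q powr (1 / s)) = real n * ((c\<^sup>2 / 2 * E) / (pi * l)\<^sup>2)"
    using n q by (simp add: E_def power_mult_distrib l2 divide_simps)
  also have "\<dots> \<le> real n * ((\<Sum>j=1..?m. (\<theta> j)\<^sup>2) / (pi * l)\<^sup>2)"
    using sum by (intro mult_left_mono divide_right_mono) auto
  also have "\<dots> \<le> real n * (L2_norm (primitive f))\<^sup>2"
    by (intro mult_left_mono L2_norm_primitive_ge f l) simp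
  finally show ?thesis by (simp add: q_def)
qed

lemma remainder_eq:
  "remainder f i = (\<lambda>x. f x - (\<Sum>j=1..i. L2_inner f (cos_basis j) * cos_basis j x))"
  by (simp add: remainder_def[abs_def] L2_inner_def)

lemma L2_remainder: "f \<in> L2_space \<Longrightarrow> remainder f i \<in> L2_space"
  unfolding remainder_eq by (intro L2_diff L2_sum L2_scale L2_cos_basis)

text \<open>The weighted tails are unbounded because \<open>f\<close> has an expansion but lies in
  no multiple of the ball. The index can be taken beyond any \<open>m\<close>, since finitely many
  tails cannot cause this.\<close>

lemma exists_large_remainder:
  fixes s P M :: real and m :: nat
  assumes "s > 0" "P > 0" "M > 0" "f \<in> L2_space" "(LINT x|unit_lborel. f x) = 0"
    and not_in: "\<And>l. l > 0 \<Longrightarrow> f \<notin> scaled_set l (besov_ball s P)"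
  shows "\<exists>i>m. M \<le> real i powr s * L2_norm (remainder f i)"
proof -
  let ?\<theta> = "\<lambda>j. L2_inner f (cos_basis j)"
  have f: "f \<in> L2_space" "L2_expansion f ?\<theta>"
    using assms L2_expansion_cos_coeffs by auto
  \<comment> \<open>The first summand bounds the weighted tail for all \<open>l < m + 1\<close>, so
    exceeding \<open>K\<close> forces \<open>l\<close> to be large. The second yields
    \<open>M\<close> after the loss of a factor 2 in rounding \<open>l\<close>.\<close>
  define K where "K = (real m + 1) powr (2 * s) * (L2_norm f)\<^sup>2 + 2 powr (2 * s) * M\<^sup>2"
  have K: "K > 0" using assms(3) by (simp add: K_def add_nonneg_pos)
  have "f \<notin> scaled_set (sqrt (K / P)) (besov_ball s P)"
    using K assms(2) by (intro not_in) simp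
  then obtain l where l: "l > 0" "K < l powr (2 * s) * (\<Sum>\<^sub>\<infinity>j\<in>{j. l < real j}. (?\<theta> j)\<^sup>2)"
    using in_scaled_besov_ball[OF f assms(2) K] by (meson not_less)
  define i where "i = nat \<lfloor>l\<rfloor>"
  have R: "K < l powr (2 * s) * (L2_norm (remainder f i))\<^sup>2"
    using l(2) by (simp only: L2_expansion_tail_infsum[OF f l(1)] i_def remainder_eq)
  have R_le: "(L2_norm (remainder f i))\<^sup>2 \<le> (L2_norm f)\<^sup>2"
    using L2_expansion_norm_split[OF f, of i] by (simp add: remainder_eq sum_nonneg)
  have ml: "real m + 1 \<le> l"
  proof (rule ccontr)
    assume "\<not> real m + 1 \<le> l"
    then have "l powr (2 * s) * (L2_norm (remainder f i))\<^sup>2 \<le> (real m + 1) powr (2 * s) * (L2_norm f)\<^sup>2"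
      using l(1) assms(1) R_le by (intro mult_mono powr_mono2) auto
    moreover have "0 \<le> 2 powr (2 * s) * M\<^sup>2" by simp
    ultimately show False using R unfolding K_def by linarith
  qed
  then have i: "i > m" unfolding i_def by (simp add: zless_nat_eq_int_zless le_floor_iff less_floor_iff)
  \<comment> \<open>Here \<open>l < i + 1\<close>, and \<open>i\<close> is at least 1.\<close>
  have "l \<le> 2 * real i" using i l(1) unfolding i_def by linarith
  have "2 powr (2 * s) * M\<^sup>2 \<le> l powr (2 * s) * (L2_norm (remainder f i))\<^sup>2"
    using R by (simp add: K_def) (smt (verit) mult_nonneg_nonneg powr_ge_zero zero_le_power2)
  also have "\<dots> \<le> (2 * real i) powr (2 * s) * (L2_norm (remainder f i))\<^sup>2"
    using \<open>l \<le> 2 * real i\<close> l(1) assms(1) by (intro mult_right_mono powr_mono2) auto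
  also have "\<dots> = 2 powr (2 * s) * (real i powr s * L2_norm (remainder f i))\<^sup>2"
    using i by (simp add: powr_mult power_mult_distrib powr_powr flip: powr_realpow) (simp add: mult.commute)
  finally have "M\<^sup>2 \<le> (real i powr s * L2_norm (remainder f i))\<^sup>2"
    by simp
  then have "M \<le> real i powr s * L2_norm (remainder f i)"
    by (rule power2_le_imp_le) simp
  with i show ?thesis by blast
qed

lemma L2_norm_primitive_remainder_le:
  assumes "f \<in> L2_space" "(LINT x|unit_lborel. f x) = 0" "i > 0"
  shows "L2_norm (primitive (remainder f i)) \<le> L2_norm (remainder f i) / (pi * real i)"
  using L2_expansion_remainder[OF L2_expansion_cos_coeffs[OF assms(1,2)], of i] assms
  by (intro L2_norm_primitive_le[where \<theta> = "\<lambda>j. if j \<le> i then 0 else L2_inner f (cos_basis j)"] L2_remainder)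
    (auto simp: remainder_eq)

text \<open>The index \<open>j\<close> below is the integer sample size at which the norm \<open>a\<close> has the critical order.\<close>

lemma rate_index:
  fixes r a B :: real
  assumes "0 < r" "0 < a" "a \<le> B"
  defines "j \<equiv> nat \<lceil>a powr (- (1 / r))\<rceil>" and "D \<equiv> 1 + B powr (1 / r)"
  shows "j > 0" "real j powr (- r) \<le> a" "a \<le> D powr r * real j powr (- r)"
    and "real j powr (1 / 2) \<le> D powr (1 / 2) * a powr (- (1 / (2 * r)))"
proof -
  define x where "x = a powr (- (1 / r))"
  have x: "x > 0" using assms by (simp add: x_def)
  have D: "D > 0" by (simp add: D_def add_pos_nonneg)
  have xj: "x \<le> real j" unfolding j_def x_def by (rule real_nat_ceiling_ge)
  then have "real j > 0" using x by linarith
  then show "j > 0" by simp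
  \<comment> \<open>Since \<open>a\<close> is at most \<open>B\<close>, the number \<open>x\<close>
    is at least \<open>B powr (- (1 / r))\<close>. Rounding up therefore costs at most the factor
    \<open>D\<close>, which does not depend on \<open>a\<close>.\<close>
  have "a powr (1 / r) \<le> B powr (1 / r)"
    using assms by (intro powr_mono2) auto
  then have "a powr (1 / r) * x \<le> B powr (1 / r) * x"
    using x by (intro mult_right_mono) auto
  moreover have "a powr (1 / r) * x = 1"
    using assms by (simp add: x_def flip: powr_add)
  ultimately have "x + 1 \<le> D * x" by (simp add: D_def algebra_simps)
  moreover have "real j \<le> x + 1"
    using x unfolding j_def x_def[symmetric] by linarith
  ultimately have jD: "real j \<le> D * x" by linarith
  have xr: "x powr (- r) = a"
    using assms by (simp add: x_def powr_powr)
  show "real j powr (- r) \<le> a"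
    using powr_mono2'[of "- r" x "real j"] x xj assms xr by simp
  have "(D * x) powr (- r) \<le> real j powr (- r)"
    using jD \<open>real j > 0\<close> assms by (intro powr_mono2') auto
  then have "D powr r * (D powr (- r) * a) \<le> D powr r * real j powr (- r)"
    using D x xr by (intro mult_left_mono) (auto simp: powr_mult)
  moreover have "D powr r * (D powr (- r) * a) = a"
    using D by (simp add: powr_minus)
  ultimately show "a \<le> D powr r * real j powr (- r)" by simp
  have "real j powr (1 / 2) \<le> (D * x) powr (1 / 2)"
    using jD by (intro powr_mono2) auto
  also have "\<dots> = D powr (1 / 2) * a powr (- (1 / (2 * r)))"
    using D x by (simp only: powr_mult x_def powr_powr) (simp add: mult.commute)
  finally show "real j powr (1 / 2) \<le> D powr (1 / 2) * a powr (- (1 / (2 * r)))" .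
qed

theorem theorem7p1:
  fixes r s P\<^sub>0 :: real and U :: "(real \<Rightarrow> real) set"
  assumes "0 < r" and "r < 1 / 2"
    and "s = 2 * r / (1 - 2 * r)"
    and "P\<^sub>0 > 0"
    and "U = besov_ball s P\<^sub>0"
  shows
    "convex_fun_set U
     \<and> (\<forall>c C. 0 < c \<and> c < C \<longrightarrow>
          (\<exists>c\<^sub>1>0. \<forall>n::nat. \<forall>f\<in>U.
             n \<ge> 1 \<and> (AE x in unit_lborel. 1 + f x \<ge> 0)
             \<and> c * real n powr (- r) < L2_norm f \<and> L2_norm f < C * real n powr (- r)
             \<longrightarrow> sqrt (real n) * cvm_T (\<lambda>x. pert_cdf f x - F0 x) > c\<^sub>1))
     \<and> (\<forall>f\<in>L2_space. (LINT x|unit_lborel. f x) = 0 \<and> (\<forall>l>0. f \<notin> scaled_set l U) \<longrightarrow>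
          (\<exists>(i :: nat \<Rightarrow> nat) (j :: nat \<Rightarrow> nat) (c\<^sub>2 :: real) (C\<^sub>2 :: real).
             (\<forall>n. i n > 0) \<and> (\<forall>n. j n > 0) \<and> filterlim i at_top sequentially
             \<and> 0 < c\<^sub>2 \<and> c\<^sub>2 \<le> C\<^sub>2
             \<and> (\<forall>n. c\<^sub>2 * real (j n) powr (- r) \<le> L2_norm (remainder f (i n))
                   \<and> L2_norm (remainder f (i n)) \<le> C\<^sub>2 * real (j n) powr (- r))
             \<and> ((\<forall>n. AE x in unit_lborel. 1 + remainder f (i n) x > 0) \<longrightarrow>
                  (\<lambda>n. real (j n) powr (1 / 2)
                        * cvm_T (\<lambda>x. pert_cdf (remainder f (i n)) x - F0 x)) \<longlonglongrightarrow> 0)))"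
proof (intro conjI allI ballI impI, goal_cases)
  have s: "s > 0" using assms by simp
  have "2 * r / s = 1 - 2 * r" using assms by simp
  then have rs: "2 * r + 2 * r / s = 1" by simp
  {
    case 1
    show ?case using assms convex_besov_ball by simp
  next
    case (2 c C)
    define K where "K = c\<^sup>2 / (2 * pi\<^sup>2 * (2 * P\<^sub>0 / c\<^sup>2) powr (1 / s))"
    have K: "K > 0" using 2 assms(4) by (simp add: K_def)
    show ?case
    \<comment> \<open>Halving \<open>K\<close> turns the weak inequality into the strict
      one.\<close>
    proof (intro exI[of _ "sqrt (K / 2)"] conjI allI ballI impI)
      show "sqrt (K / 2) > 0" using K by simp
      fix n :: nat and f
      assume f: "f \<in> U" and h: "n \<ge> 1 \<and> (AE x in unit_lborel. 1 + f x \<ge> 0)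
        \<and> c * real n powr (- r) < L2_norm f \<and> L2_norm f < C * real n powr (- r)"
      then have fL: "f \<in> L2_space" using assms(4,5) by (simp add: besov_ball_iff)
      have "sqrt (K / 2) < sqrt K" using K by simp
      also have "\<dots> \<le> sqrt (real n * (L2_norm (primitive f))\<^sup>2)"
        unfolding K_def using f h 2 s rs assms(4,5)
        by (intro real_sqrt_le_mono besov_ball_primitive_lower_bound) auto
      also have "\<dots> = sqrt (real n) * cvm_T (\<lambda>x. pert_cdf f x - F0 x)"
        using h fL by (simp add: real_sqrt_mult cvm_T_eq_L2_norm_primitive)
      finally show "sqrt (real n) * cvm_T (\<lambda>x. pert_cdf f x - F0 x) > sqrt (K / 2)" .
    qed
  next
    case (3 f)
    then have f: "f \<in> L2_space" "(LINT x|unit_lborel. f x) = 0" by auto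
    \<comment> \<open>The bound \<open>sqrt (n + 1)\<close> may be any positive sequence tending to
      infinity; this one gives an explicit rate below.\<close>
    have "\<exists>i>n. sqrt (real n + 1) \<le> real i powr s * L2_norm (remainder f i)" for n
      using 3 s assms(4,5) by (intro exists_large_remainder[where P = P\<^sub>0]) auto
    then obtain i where i: "\<And>n. i n > n"
      and large: "\<And>n. sqrt (real n + 1) \<le> real (i n) powr s * L2_norm (remainder f (i n))"
      by metis
    define a where "a n = L2_norm (remainder f (i n))" for n
    have a: "a n > 0" for n
    proof -
      have "a n \<noteq> 0" using large[of n] by (auto simp: a_def not_le)
      then show ?thesis by (simp add: a_def less_le)
    qed
    \<comment> \<open>A common bound for the remainders makes the rounding constant \<open>D\<close>
      independent of \<open>n\<close>.\<close>
    define B where "B = L2_norm f"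
    have aB: "a n \<le> B" for n
      unfolding a_def B_def
      by (rule power2_le_imp_le)
        (use L2_expansion_norm_split[OF f(1) L2_expansion_cos_coeffs[OF f], of "i n"] in
          \<open>simp_all add: remainder_eq sum_nonneg\<close>)
    define j where "j n = nat \<lceil>a n powr (- (1 / r))\<rceil>" for n
    define D where "D = 1 + B powr (1 / r)"
    note rate = rate_index[OF assms(1) a aB, folded j_def D_def]
    have D1: "1 \<le> D" by (simp add: D_def)
    have exponent: "1 - 1 / (2 * r) = - (1 / s)"
      using assms(1) unfolding assms(3) by (simp add: diff_divide_distrib)
    \<comment> \<open>By the exponent identity, the power of \<open>a n\<close> left over combines
      with \<open>1 / i n\<close> into a negative power of the large quantity
      \<open>i n powr s * a n\<close>. The factor \<open>pi\<close> is only estimated below by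
      1.\<close>
    have key: "real (j n) powr (1 / 2) * (a n / (pi * real (i n)))
        \<le> D powr (1 / 2) * (real n + 1) powr (- (1 / (2 * s)))" for n
    proof -
      have ipos: "real (i n) > 0" using i[of n] by simp
      have "real (j n) powr (1 / 2) * (a n / (pi * real (i n)))
          \<le> (D powr (1 / 2) * a n powr (- (1 / (2 * r)))) * (a n / (1 * real (i n)))"
        using a[of n] ipos pi_ge_two rate(4)[of n]
        by (intro mult_mono divide_left_mono mult_right_mono) (auto intro: less_imp_le)
      also have "\<dots> = D powr (1 / 2) * (a n powr (1 - 1 / (2 * r)) / real (i n))"
        using a[of n] by (simp add: powr_diff powr_minus field_simps)
      also have "a n powr (1 - 1 / (2 * r)) / real (i n) = (real (i n) powr s * a n) powr (- (1 / s))"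
        using a[of n] ipos s
        unfolding exponent by (simp add: powr_mult powr_powr powr_minus divide_simps)
      also have "\<dots> \<le> sqrt (real n + 1) powr (- (1 / s))"
        using large[of n] s by (intro powr_mono2') (auto simp: a_def)
      also have "\<dots> = (real n + 1) powr (- (1 / (2 * s)))"
        by (simp add: powr_half_sqrt[symmetric] powr_powr)
      finally show ?thesis by (simp add: mult_left_mono)
    qed
    show ?case
    \<comment> \<open>The lower constant is 1 because \<open>j\<close> is rounded upwards; the upper
      one accounts for the rounding.\<close>
    proof (rule exI[of _ i], rule exI[of _ j], rule exI[of _ 1], rule exI[of _ "D powr r"],
        intro conjI allI impI)
      show "i n > 0" for n using i[of n] by simp
      show "filterlim i at_top sequentially"
        using i by (intro filterlim_at_top_mono[OF filterlim_ident])
          (auto intro: always_eventually less_imp_le)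
      show "1 \<le> D powr r" using D1 assms(1) by (simp add: ge_one_powr_ge_zero)
      assume pos: "\<forall>n. AE x in unit_lborel. 1 + remainder f (i n) x > 0"
      have T: "cvm_T (\<lambda>x. pert_cdf (remainder f (i n)) x - F0 x)
          = L2_norm (primitive (remainder f (i n)))" for n
      proof (rule cvm_T_eq_L2_norm_primitive[OF L2_remainder[OF f(1)]])
        show "AE x in unit_lborel. 1 + remainder f (i n) x \<ge> 0"
          using pos[rule_format, of n] by eventually_elim simp
      qed
      have le: "real (j n) powr (1 / 2) * cvm_T (\<lambda>x. pert_cdf (remainder f (i n)) x - F0 x)
          \<le> D powr (1 / 2) * (real n + 1) powr (- (1 / (2 * s)))" for n
        unfolding T
      proof (rule order_trans[OF mult_left_mono key])
        show "L2_norm (primitive (remainder f (i n))) \<le> a n / (pi * real (i n))"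
          unfolding a_def using i[of n] by (intro L2_norm_primitive_remainder_le f) simp
      qed simp
      have lim: "(\<lambda>n. D powr (1 / 2) * (real n + 1) powr (- (1 / (2 * s)))) \<longlonglongrightarrow> 0"
      proof (intro tendsto_mult_right_zero tendsto_neg_powr)
        show "filterlim (\<lambda>n. real n + 1) at_top sequentially"
          by (rule filterlim_at_top_mono[OF filterlim_real_sequentially]) simp
      qed (use s in simp)
      show "(\<lambda>n. real (j n) powr (1 / 2)
          * cvm_T (\<lambda>x. pert_cdf (remainder f (i n)) x - F0 x)) \<longlonglongrightarrow> 0"
        by (rule Lim_null_comparison[OF always_eventually lim])
          (use le in \<open>simp add: T\<close>)
    qed (use rate in \<open>auto simp: a_def\<close>)
  }
qed

end
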